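(* Let $n\ge1$, let $K_n$ be the complete graph on $n$ vertices, and let $\chi(K_n)=n-\binom{n}{2}$. For every integer $b$ with $1\le b\le n$ and $b\equiv\chi(K_n)\pmod 2$ there is an edge-labeling of $K_n$ whose monodromy $\mu(K_n)$ has exactly $b$ disjoint cycles (equivalently, whose associated properly embedded graph $P(K_n)$ has exactly $b$ boundary components). Moreover, every conjugacy class of $\mathcal{S}_n$ whose elements have a number $b$ of disjoint cycles satisfying $b\equiv\chi(K_n)\pmod2$ contains the monodromy of some edge-labeling of $K_n$.
   Context: An edge-labeling of a graph with $m$ edges is a bijective labeling of its edges by $[m]=\{1,\dots,m\}$ (here the vertex set is identified with $[n]$ and $m=\binom n2$). The monodromy of an edge-labeled graph is the product $\tau_1\tau_2\cdots\tau_m$ (multiplied from left to right) where $\tau_i$ is the transposition interchanging the endpoints of the edge labeled $i$. The disjoint cycles of a permutation include its fixed points, as cycles of length $1$. The properly embedded graph $P(\Gamma)$ of an edge-labeled graph $\Gamma$ lies in the compact oriented surface with boundary constructed as follows: for each vertex $v$ with incident edges $e_1<\dots<e_d$ (ordered by label) take an oriented disc thickening the star of $v$, modeled on a neighborhood in the closed upper half plane with $v$ at the origin on the boundary line, the half-edges drawn from $v$ into the upper half plane with $e_1,\dots,e_d$ in counterclockwise order starting from the right, each thickened to a ribbon with a free end; then, for each edge, glue the free ends of the ribbons of its two half-edges by an orientation-reversing homeomorphism of intervals. Its boundary components are in bijection with the disjoint cycles of the monodromy of $\Gamma$. (The conditions $b\le n$ and $b\equiv\chi(\Gamma)\pmod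 2$ are necessary for every edge-labeled graph $\Gamma$ with $n$ vertices, where $\chi(\Gamma)$ is the number of vertices minus the number of edges.) *)

theory Defs
  imports "HOL-Analysis.Analysis" "HOL-Combinatorics.Orbits" "HOL-Number_Theory.Cong"
begin

section \<open>Edge-labeled graphs and their monodromy\<close>

text \<open>A finite simple graph is given by a set \<open>V\<close> of vertices and a set \<open>E\<close> of edges, each edge
  being the two-element set of its endpoints.\<close>

definition complete_edges :: "nat \<Rightarrow> nat set set" where
  "complete_edges n = {{u, v} | u v. u \<in> {1..n} \<and> v \<in> {1..n} \<and> u \<noteq> v}"

definition edge_labeling :: "nat set set \<Rightarrow> (nat set \<Rightarrow> nat) \<Rightarrow> bool" where
  "edge_labeling E l \<longleftrightarrow> bij_betw l E {1..card E}"

definition edge_transposition :: "nat set \<Rightarrow> nat \<Rightarrow> nat" where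
  "edge_transposition e = Transposition.transpose (Min e) (Max e)"

text \<open>The product is taken from left to right: \<open>\<tau>\<^sub>1\<close> is applied first and \<open>\<tau>\<^sub>m\<close> last.\<close>

definition monodromy :: "nat set set \<Rightarrow> (nat set \<Rightarrow> nat) \<Rightarrow> nat \<Rightarrow> nat" where
  "monodromy E l =
     fold (\<lambda>i p. edge_transposition (inv_into E l i) \<circ> p) [1..<Suc (card E)] id"

text \<open>The disjoint cycles of a permutation of \<open>{1..n}\<close>, fixed points included, correspond to its
  orbits.\<close>

definition num_cycles :: "nat \<Rightarrow> (nat \<Rightarrow> nat) \<Rightarrow> nat" where
  "num_cycles n p = card (orbit p ` {1..n})"

definition conjugacy_class :: "nat \<Rightarrow> (nat \<Rightarrow> nat) \<Rightarrow> (nat \<Rightarrow> nat) set" where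
  "conjugacy_class n p = {q \<circ> p \<circ> inv q | q. q permutes {1..n}}"

definition conjugacy_classes :: "nat \<Rightarrow> (nat \<Rightarrow> nat) set set" where
  "conjugacy_classes n = conjugacy_class n ` {p. p permutes {1..n}}"


section \<open>Quotient topologies\<close>

definition quotient_topology :: "'a topology \<Rightarrow> ('a \<Rightarrow> 'b) \<Rightarrow> 'b topology" where
  "quotient_topology X q =
     topology (\<lambda>U. U \<subseteq> q ` topspace X \<and> openin X {x \<in> topspace X. q x \<in> U})"

lemma openin_quotient_topology:
  "openin (quotient_topology X q) U \<longleftrightarrow>
     U \<subseteq> q ` topspace X \<and> openin X {x \<in> topspace X. q x \<in> U}"
proof -
  have "istopology (\<lambda>U. U \<subseteq> q ` topspace X \<and> openin X {x \<in> topspace X. q x \<in> U})"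
    (is "istopology ?P")
    unfolding istopology_def
  proof (intro conjI allI impI)
    fix S T assume ST: "?P S" "?P T"
    have eq: "{x \<in> topspace X. q x \<in> S \<inter> T}
        = {x \<in> topspace X. q x \<in> S} \<inter> {x \<in> topspace X. q x \<in> T}" by auto
    show "S \<inter> T \<subseteq> q ` topspace X" using ST by blast
    show "openin X {x \<in> topspace X. q x \<in> S \<inter> T}"
      unfolding eq using ST by (intro openin_Int) simp_all
  next
    fix K assume K: "\<forall>S\<in>K. ?P S"
    show "\<Union>K \<subseteq> q ` topspace X" using K by blast
    have eq: "{x \<in> topspace X. q x \<in> \<Union>K} = \<Union>((\<lambda>S. {x \<in> topspace X. q x \<in> S}) ` K)" by auto
    show "openin X {x \<in> topspace X. q x \<in> \<Union>K}"
      unfolding eq using K by (intro openin_Union) blast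
  qed
  from topology_inverse'[OF this] show ?thesis
    unfolding quotient_topology_def by (rule fun_cong[THEN trans]) (rule refl)
qed

lemma topspace_quotient_topology: "topspace (quotient_topology X q) = q ` topspace X"
proof (rule subset_antisym)
  show "topspace (quotient_topology X q) \<subseteq> q ` topspace X"
    using openin_topspace[of "quotient_topology X q"]
    unfolding openin_quotient_topology by (rule conjunct1)
  have "{x \<in> topspace X. q x \<in> q ` topspace X} = topspace X" by blast
  then have "openin (quotient_topology X q) (q ` topspace X)"
    unfolding openin_quotient_topology by simp
  then show "q ` topspace X \<subseteq> topspace (quotient_topology X q)"
    by (rule openin_subset)
qed

lemma quotient_map_quotient_topology: "quotient_map X (quotient_topology X q) q"
  unfolding quotient_map_def topspace_quotient_topology openin_quotient_topology by blast


section \<open>The surface containing the properly embedded graph\<close>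

text \<open>The oriented disc thickening the star of a vertex of degree \<open>d\<close> is modeled by the closed
  upper half of the unit disc, with the vertex at the origin. The half-edge of the \<open>k\<close>-th incident
  edge is the radius at angle \<open>k\<pi>/(d+1)\<close>, and the free end of its ribbon is the arc of the unit
  circle of angular half-width \<open>\<pi>/(4(d+1))\<close> around the end of that radius; so the free
  ends are pairwise disjoint and do not meet the real line.\<close>

definition half_disc :: "complex set" where
  "half_disc = {z. cmod z \<le> 1 \<and> 0 \<le> Im z}"

definition incident_edges :: "nat set set \<Rightarrow> nat \<Rightarrow> nat set set" where
  "incident_edges E v = {e \<in> E. v \<in> e}"

definition edge_rank :: "nat set set \<Rightarrow> (nat set \<Rightarrow> nat) \<Rightarrow> nat \<Rightarrow> nat set \<Rightarrow> nat" where
  "edge_rank E l v e = card {f \<in> incident_edges E v. l f \<le> l e}"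

text \<open>For \<open>s\<close> running from \<open>-1\<close> to \<open>1\<close>, this parametrizes the free end at \<open>v\<close> of the ribbon of \<open>e\<close>
  counterclockwise, that is, in the boundary orientation of the disc.\<close>

definition ribbon_end ::
    "nat set set \<Rightarrow> (nat set \<Rightarrow> nat) \<Rightarrow> nat \<Rightarrow> nat set \<Rightarrow> real \<Rightarrow> complex" where
  "ribbon_end E l v e s =
     (let d = real (card (incident_edges E v))
      in cis (real (edge_rank E l v e) * pi / (d + 1) + s * (pi / (4 * (d + 1)))))"

definition vertex_discs :: "nat set \<Rightarrow> (nat \<times> complex) set" where
  "vertex_discs V = V \<times> half_disc"

text \<open>The parameter \<open>s\<close> at one end of an edge is matched with \<open>-s\<close> at the other end, so the gluing
  reverses orientation. Since both orderings of the endpoints occur, the relation is symmetric.\<close>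

definition gluing ::
    "nat set set \<Rightarrow> (nat set \<Rightarrow> nat) \<Rightarrow> ((nat \<times> complex) \<times> (nat \<times> complex)) set" where
  "gluing E l =
     {((u, ribbon_end E l u {u, v} s), (v, ribbon_end E l v {u, v} (- s))) | u v s.
        {u, v} \<in> E \<and> u \<noteq> v \<and> s \<in> {-1..1}}"

definition surface_point ::
    "nat set set \<Rightarrow> (nat set \<Rightarrow> nat) \<Rightarrow> nat \<times> complex \<Rightarrow> (nat \<times> complex) set" where
  "surface_point E l p = (gluing E l)\<^sup>* `` {p}"

definition surface ::
    "nat set \<Rightarrow> nat set set \<Rightarrow> (nat set \<Rightarrow> nat) \<Rightarrow> (nat \<times> complex) set topology" where
  "surface V E l = quotient_topology (top_of_set (vertex_discs V)) (surface_point E l)"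

text \<open>The boundary of the surface consists of the images of those boundary points of the discs
  that are not interior to one of the glued intervals; the end points of these intervals remain
  on the boundary.\<close>

definition surface_boundary ::
    "nat set \<Rightarrow> nat set set \<Rightarrow> (nat set \<Rightarrow> nat) \<Rightarrow> (nat \<times> complex) set set" where
  "surface_boundary V E l =
     surface_point E l ` (SIGMA v:V. frontier half_disc -
       (\<Union>e\<in>incident_edges E v. ribbon_end E l v e ` {-1<..<1}))"

definition num_boundary_components :: "nat set \<Rightarrow> nat set set \<Rightarrow> (nat set \<Rightarrow> nat) \<Rightarrow> nat" where
  "num_boundary_components V E l =
     card (connected_components_of (subtopology (surface V E l) (surface_boundary V E l)))"

end

theory Submission
  imports Defs
begin

text \<open>
  The statement has an algebraic and a topological half.

  Algebra. The product of all transpositions of \<open>n\<close> points, in any order, has sign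
  \<open>(-1) ^ (n choose 2)\<close>, and the sign of a permutation with \<open>b\<close> cycles is \<open>(-1) ^ (n + b)\<close>
  (\<open>sign_card_orbits\<close>); this is the congruence on \<open>b\<close>. Conversely, every single permutation with this
  sign, and not only some member of its conjugacy class, is such a product (\<open>ordered_product_complete\<close>).
  If \<open>p\<close> moves \<open>x\<close> to \<open>y\<close>, let the star at \<open>x\<close> come last and begin with the edge from \<open>x\<close> to \<open>y\<close>.
  The star carries \<open>x\<close> to \<open>y\<close> too, so the product of the other edges has to be a permutation fixing
  \<open>x\<close>, and induction applies. This fails only for the identity, where \<open>n\<close> is 0 or 1 modulo 4. There the
  complete graph decomposes into complete graphs on blocks of four vertices (five, if one
  vertex is shared by all blocks) and complete bipartite graphs between blocks, and each of these pieces
  has an order with trivial product, built from the relation that the four edges between two pairs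
  multiply to the swaps inside the pairs (\<open>edge_product_K22\<close>, \<open>ordered_product_complete_id\<close>).

  Topology. For every edge-labeled graph the components of the boundary of the surface correspond to the
  cycles of the monodromy (\<open>card_boundary_components\<close>). Following the boundary from the vertex \<open>u\<close>,
  one meets the ribbon with the smallest label at \<open>u\<close>, runs along it to the next vertex, continues with the
  next larger label there, and so on until no larger label is left: this is how the monodromy moves
  \<open>u\<close>. The boundary is thus a union of strands, one for each vertex \<open>u\<close>, which are connected
  (\<open>connectedin_strand\<close>), closed under the gluing (\<open>strand_gluing\<close>), and meet only if their
  vertices lie in the same cycle (\<open>strand_meet\<close>), while the strand of \<open>u\<close> ends where the strand
  of the image of \<open>u\<close> begins. So the strands of one cycle form a connected set that is open and
  closed in the boundary.
\<close>

section \<open>Products of transpositions along an order of the edges\<close>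

abbreviation transposition :: "'a \<Rightarrow> 'a \<Rightarrow> 'a \<Rightarrow> 'a" where
  "transposition \<equiv> Transposition.transpose"

definition complete_on :: "nat set \<Rightarrow> nat set set" where
  "complete_on V = {{u, v} | u v. u \<in> V \<and> v \<in> V \<and> u \<noteq> v}"

definition edge_product :: "nat set list \<Rightarrow> nat \<Rightarrow> nat" where
  "edge_product xs = fold (\<lambda>e p. edge_transposition e \<circ> p) xs id"

text \<open>Ordering the edges of a graph amounts to labeling it, and the \<open>edge_product\<close> of the order is
  then the monodromy. Lists concatenate, which labelings do not, so orders of disjoint edge sets can
  be combined; vertex sets other than an initial segment of the naturals are needed for induction.\<close>

definition ordered_product :: "nat set set \<Rightarrow> (nat \<Rightarrow> nat) \<Rightarrow> bool" where
  "ordered_product E p \<longleftrightarrow> (\<exists>xs. distinct xs \<and> set xs = E \<and> edge_product xs = p)"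

lemma edge_transposition_pair: "edge_transposition {a, b} = transposition a b"
  by (cases "a \<le> b") (auto simp: edge_transposition_def min_def max_def Transposition.transpose_commute)

lemma edge_product_Nil [simp]: "edge_product [] = id"
  by (simp add: edge_product_def)

lemma edge_product_snoc: "edge_product (xs @ [e]) = edge_transposition e \<circ> edge_product xs"
  by (simp add: edge_product_def)

lemma edge_product_append: "edge_product (xs @ ys) = edge_product ys \<circ> edge_product xs"
  by (induction ys rule: rev_induct)
     (simp_all add: edge_product_snoc comp_assoc flip: append_assoc)

lemma edge_product_Cons: "edge_product (e # xs) = edge_product xs \<circ> edge_transposition e"
  using edge_product_append[of "[e]" xs] edge_product_snoc[of "[]" e] by simp

lemma complete_onE:
  assumes "e \<in> complete_on V"
  obtains u v where "e = {u, v}" "u \<in> V" "v \<in> V" "u \<noteq> v"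
  using assms unfolding complete_on_def by blast

lemma edge_product_permutes:
  assumes "set xs \<subseteq> complete_on V"
  shows "edge_product xs permutes V"
  using assms
proof (induction xs)
  case Nil
  show ?case by (simp only: edge_product_Nil permutes_id)
next
  case (Cons e xs)
  then obtain u v where "e = {u, v}" "u \<in> V" "v \<in> V" by (auto elim: complete_onE)
  then have "edge_transposition e permutes V"
    by (simp add: edge_transposition_pair permutes_swap_id)
  moreover have "edge_product xs permutes V" using Cons by simp
  ultimately show ?case unfolding edge_product_Cons by (rule permutes_compose)
qed

lemma sign_edge_product:
  assumes "finite V" "set xs \<subseteq> complete_on V"
  shows "sign (edge_product xs) = (-1) ^ length xs"
  using assms(2)
proof (induction xs)
  case Nil
  show ?case by simp
next
  case (Cons e xs)
  then obtain u v where e: "e = {u, v}" "u \<in> V" "v \<in> V" "u \<noteq> v" by (auto elim: complete_onE)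
  have "permutation (edge_product xs)"
    using Cons.prems assms(1) edge_product_permutes permutation_permutes by auto
  then have "sign (edge_product (e # xs)) = sign (edge_product xs) * sign (transposition u v)"
    unfolding edge_product_Cons e(1) edge_transposition_pair
    by (intro sign_compose permutation_swap_id)
  then show ?case using Cons e(4) by (simp add: sign_swap_id)
qed

lemma edge_product_fixes:
  assumes "\<forall>e\<in>set xs. \<exists>a b. e = {a, b} \<and> v \<noteq> a \<and> v \<noteq> b"
  shows "edge_product xs v = v"
  using assms by (induction xs) (auto simp: edge_product_Cons edge_transposition_pair)

lemma ordered_product_Un:
  assumes "ordered_product E p" "ordered_product F q" "E \<inter> F = {}"
  shows "ordered_product (E \<union> F) (q \<circ> p)"
proof -
  obtain xs ys where "distinct xs" "set xs = E" "edge_product xs = p"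
    "distinct ys" "set ys = F" "edge_product ys = q"
    using assms unfolding ordered_product_def by blast
  then have "distinct (xs @ ys)" "set (xs @ ys) = E \<union> F" "edge_product (xs @ ys) = q \<circ> p"
    using assms(3) by (auto simp: edge_product_append)
  then show ?thesis unfolding ordered_product_def by blast
qed

section \<open>Complete graphs whose transpositions multiply to the identity\<close>

definition join_edges :: "nat set \<Rightarrow> nat set \<Rightarrow> nat set set" where
  "join_edges A B = {{a, b} | a b. a \<in> A \<and> b \<in> B}"

text \<open>The four edges joining two pairs act as the swap inside each pair. Disjoint swaps commute and are
  involutions, so everything built from these four-edge blocks cancels as soon as each pair is used
  an even number of times.\<close>

lemma edge_product_K22:
  assumes "distinct [a, b, c, d]"
  shows "edge_product [{a, c}, {b, d}, {a, d}, {b, c}] = transposition a b \<circ> transposition c d"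
  using assms
  by (auto simp: fun_eq_iff edge_product_Cons edge_transposition_pair Transposition.transpose_def)

lemma complete_on_empty [simp]: "complete_on {} = {}"
  by (simp add: complete_on_def)

lemma complete_on_insert:
  assumes "x \<notin> A"
  shows "complete_on (insert x A) = (\<lambda>a. {x, a}) ` A \<union> complete_on A"
proof (intro set_eqI iffI)
  fix e assume "e \<in> complete_on (insert x A)"
  then obtain u v where "e = {u, v}" "u \<in> insert x A" "v \<in> insert x A" "u \<noteq> v"
    by (rule complete_onE)
  then show "e \<in> (\<lambda>a. {x, a}) ` A \<union> complete_on A"
    unfolding complete_on_def by blast
next
  fix e assume "e \<in> (\<lambda>a. {x, a}) ` A \<union> complete_on A"
  then show "e \<in> complete_on (insert x A)"
    using assms unfolding complete_on_def by blast
qed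

lemma transposition_disjoint_commute:
  assumes "distinct [a, b, c, d]"
  shows "transposition a b \<circ> transposition c d = transposition c d \<circ> transposition a b"
  using assms by (auto simp: fun_eq_iff Transposition.transpose_def)

text \<open>The two pairs cost one swap each, and the edges between the pairs undo both swaps.\<close>

lemma ordered_product_K4:
  assumes "distinct [a, b, c, d]"
  shows "ordered_product (complete_on {a, b, c, d}) id"
proof -
  let ?xs = "[{a, b}] @ [{c, d}] @ [{a, c}, {b, d}, {a, d}, {b, c}]"
  have rev: "distinct [d, c, b, a]" using assms by auto
  have "edge_product ?xs = (transposition a b \<circ> transposition c d) \<circ> (transposition c d \<circ> transposition a b)"
    by (simp only: edge_product_append edge_product_K22[OF assms])
       (simp add: edge_product_Cons edge_transposition_pair fun_eq_iff)
  also have "\<dots> = id"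
    by (simp add: fun_eq_iff)
  finally have "edge_product ?xs = id" .
  moreover have "distinct ?xs" using assms rev by (simp add: doubleton_eq_iff)
  moreover have "set ?xs = complete_on {a, b, c, d}"
    using assms by (simp add: complete_on_insert insert_commute)
  ultimately show ?thesis unfolding ordered_product_def by blast
qed

text \<open>A triangle acts like one of its edges: attaching an extra vertex \<open>x\<close> to a pair changes nothing if
  the edge inside the pair is replaced by this triangle.\<close>

lemma edge_product_triangle:
  assumes "distinct [x, u, v]"
  shows "edge_product [{u, x}, {u, v}, {v, x}] = transposition u v"
  using assms
  by (auto simp: fun_eq_iff edge_product_Cons edge_transposition_pair Transposition.transpose_def)

text \<open>The order used for four vertices, with the edge inside each pair replaced by a triangle through
  the fifth vertex.\<close>

lemma ordered_product_K5:
  assumes "distinct [x, a, b, c, d]"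
  shows "ordered_product (complete_on {x, a, b, c, d}) id"
proof -
  let ?xs = "[{a, x}, {a, b}, {b, x}] @ [{c, x}, {c, d}, {d, x}] @ [{a, c}, {b, d}, {a, d}, {b, c}]"
  have rev: "distinct [d, c, b, a, x]" using assms by auto
  have d: "distinct [x, a, b]" "distinct [x, c, d]" "distinct [a, b, c, d]" using assms by auto
  have "edge_product ?xs = (transposition a b \<circ> transposition c d) \<circ> (transposition c d \<circ> transposition a b)"
    by (simp only: edge_product_append edge_product_K22[OF d(3)] edge_product_triangle[OF d(1)]
        edge_product_triangle[OF d(2)] comp_assoc)
  also have "\<dots> = id"
    by (simp add: fun_eq_iff)
  finally have "edge_product ?xs = id" .
  moreover have "distinct ?xs" using assms rev by (simp add: doubleton_eq_iff)
  moreover have "set ?xs = complete_on {x, a, b, c, d}"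
    using assms rev by (simp add: complete_on_insert insert_commute)
  ultimately show ?thesis unfolding ordered_product_def by blast
qed

text \<open>Both sides are split into two pairs. Each of the four pairs belongs to two of the four blocks, so
  its swap occurs twice and cancels.\<close>

lemma ordered_product_K44:
  assumes "distinct [a, b, c, d, a', b', c', d']"
  shows "ordered_product (join_edges {a, b, c, d} {a', b', c', d'}) id"
proof -
  define q where "q u v w z = [{u, w}, {v, z}, {u, z}, {v, w}]" for u v w z :: nat
  let ?xs = "(q a b a' b' @ q a b c' d') @ (q c d c' d' @ q c d a' b')"
  have half: "edge_product (q u v w z @ q u v w' z') = transposition w' z' \<circ> transposition w z"
    if "distinct [u, v, w, z, w', z']" for u v w z w' z'
  proof -
    have d: "distinct [u, v, w, z]" "distinct [u, v, w', z']" using that by auto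
    have "edge_product (q u v w z @ q u v w' z')
        = (transposition w' z' \<circ> transposition u v) \<circ> (transposition u v \<circ> transposition w z)"
      by (simp only: q_def edge_product_append edge_product_K22[OF d(1)]
          edge_product_K22[OF d(2)] transposition_disjoint_commute[OF d(2)])
    then show ?thesis by (simp add: fun_eq_iff)
  qed
  have rev: "distinct [d', c', b', a', d, c, b, a]" using assms by auto
  have d: "distinct [a, b, a', b', c', d']" "distinct [c, d, c', d', a', b']" using assms by auto
  have "edge_product ?xs = (transposition a' b' \<circ> transposition c' d') \<circ> (transposition c' d' \<circ> transposition a' b')"
    by (simp only: edge_product_append[of "q a b a' b' @ q a b c' d'"] half[OF d(1)] half[OF d(2)])
  also have "\<dots> = id"
    by (simp add: fun_eq_iff)
  finally have "edge_product ?xs = id" .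
  moreover have "distinct ?xs" using assms rev by (simp add: q_def doubleton_eq_iff)
  moreover have "set ?xs = join_edges {a, b, c, d} {a', b', c', d'}"
  proof -
    have "set (q u v w z) = join_edges {u, v} {w, z}" for u v w z
      unfolding q_def join_edges_def by auto
    moreover have "join_edges (A \<union> B) (C \<union> D)
        = join_edges A C \<union> join_edges A D \<union> (join_edges B D \<union> join_edges B C)" for A B C D
      unfolding join_edges_def by blast
    from this[of "{a, b}" "{c, d}" "{a', b'}" "{c', d'}"]
    have "join_edges {a, b, c, d} {a', b', c', d'} = join_edges {a, b} {a', b'} \<union>
        join_edges {a, b} {c', d'} \<union> (join_edges {c, d} {c', d'} \<union> join_edges {c, d} {a', b'})"
      by (simp only: Un_insert_left Un_empty_left)
    ultimately show ?thesis by (simp only: set_append)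
  qed
  ultimately show ?thesis unfolding ordered_product_def by blast
qed

lemma card_4_obtain:
  assumes "card B = 4"
  obtains a b c d where "B = {a, b, c, d}" "distinct [a, b, c, d]"
proof -
  from assms obtain a B1 where "B = insert a B1" "a \<notin> B1" "card B1 = 3"
    using card_Suc_eq[of B 3] by auto
  moreover from this obtain b c d where "B1 = {b, c, d}" "b \<noteq> c" "c \<noteq> d" "b \<noteq> d"
    by (auto simp: card_3_iff)
  ultimately show thesis using that[of a b c d] by auto
qed

lemma ordered_product_join:
  assumes "card A = 4 * k" "finite A" "card B = 4" "A \<inter> B = {}"
  shows "ordered_product (join_edges A B) id"
  using assms
proof (induction k arbitrary: A)
  case 0
  then have "join_edges A B = set []" by (simp add: join_edges_def)
  then show ?case unfolding ordered_product_def by (metis distinct.simps(1) edge_product_Nil)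
next
  case (Suc k)
  from Suc.prems obtain A1 where A1: "A1 \<subseteq> A" "card A1 = 4"
    by (metis obtain_subset_with_card_n le_add1 mult_Suc_right)
  define A2 where "A2 = A - A1"
  have A2: "card A2 = 4 * k" "finite A2" "A2 \<inter> B = {}" "A = A2 \<union> A1" "A2 \<inter> A1 = {}" "A1 \<inter> B = {}"
    using A1 Suc.prems finite_subset[OF A1(1)] by (auto simp: A2_def card_Diff_subset)
  obtain a b c d where a: "A1 = {a, b, c, d}" "distinct [a, b, c, d]"
    using card_4_obtain A1 by blast
  obtain a' b' c' d' where b: "B = {a', b', c', d'}" "distinct [a', b', c', d']"
    using card_4_obtain Suc.prems by blast
  have "distinct [a, b, c, d, a', b', c', d']" using a b A2(6) by auto
  from ordered_product_K44[OF this] have "ordered_product (join_edges A1 B) id"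
    by (simp only: a b)
  from ordered_product_Un[OF Suc.IH[OF A2(1,2) Suc.prems(3) A2(3)] this, unfolded id_comp]
  have "ordered_product (join_edges A2 B \<union> join_edges A1 B) id"
    if "join_edges A2 B \<inter> join_edges A1 B = {}" using that by simp
  moreover have "join_edges A B = join_edges A2 B \<union> join_edges A1 B"
    unfolding A2(4) join_edges_def by blast
  moreover have "join_edges A2 B \<inter> join_edges A1 B = {}"
    using A2 unfolding join_edges_def by (auto simp: doubleton_eq_iff)
  ultimately show ?case by metis
qed

text \<open>The vertices are grouped into blocks of four, with at most one vertex left over. Each block
  together with the left-over vertex is a complete graph on four or five vertices, any two blocks are
  joined by a complete bipartite graph, and these pieces share no edge. All of them can be ordered
  with trivial product.\<close>

lemma ordered_product_complete_id:
  assumes "card A = 4 * k" "finite A" "finite X" "card X \<le> 1" "A \<inter> X = {}"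
  shows "ordered_product (complete_on (A \<union> X)) id"
  using assms
proof (induction k arbitrary: A)
  case 0
  then have "complete_on (A \<union> X) = set []"
    by (auto simp: complete_on_def card_le_Suc0_iff_eq)
  then show ?case unfolding ordered_product_def by (metis distinct.simps(1) edge_product_Nil)
next
  case (Suc k)
  from Suc.prems obtain B where B: "B \<subseteq> A" "card B = 4"
    by (metis obtain_subset_with_card_n le_add1 mult_Suc_right)
  define A2 where "A2 = A - B"
  have A2: "card A2 = 4 * k" "finite A2" "A2 \<inter> X = {}" "A = A2 \<union> B" "A2 \<inter> B = {}" "B \<inter> X = {}"
    using B Suc.prems finite_subset[OF B(1)] by (auto simp: A2_def card_Diff_subset)
  obtain a b c d where a: "B = {a, b, c, d}" "distinct [a, b, c, d]"
    using card_4_obtain B by blast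
  have X1: "u = v" if "u \<in> X" "v \<in> X" for u v
    using that Suc.prems by (simp add: card_le_Suc0_iff_eq)
  have block: "ordered_product (complete_on (B \<union> X)) id"
  proof (cases "X = {}")
    case True
    then show ?thesis using ordered_product_K4[OF a(2)] a by simp
  next
    case False
    then obtain x where "X = {x}" using X1 by blast
    then show ?thesis using ordered_product_K5[of x a b c d] a A2(6) by simp
  qed
  have "complete_on (A2 \<union> X) \<inter> complete_on (B \<union> X) = {}"
    using A2 X1 unfolding complete_on_def by (auto simp: doubleton_eq_iff)
  from ordered_product_Un[OF Suc.IH[OF A2(1,2) Suc.prems(3,4) A2(3)] block this, unfolded id_comp]
  have 1: "ordered_product (complete_on (A2 \<union> X) \<union> complete_on (B \<union> X)) id" .
  have 2: "ordered_product (join_edges A2 B) id"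
    using A2 B by (intro ordered_product_join)
  have 3: "(complete_on (A2 \<union> X) \<union> complete_on (B \<union> X)) \<inter> join_edges A2 B = {}"
    using A2 unfolding complete_on_def join_edges_def by (auto simp: doubleton_eq_iff)
  have 4: "complete_on (A \<union> X) = (complete_on (A2 \<union> X) \<union> complete_on (B \<union> X)) \<union> join_edges A2 B"
    unfolding A2(4)
  proof (intro subset_antisym subsetI)
    fix e assume "e \<in> complete_on (A2 \<union> B \<union> X)"
    then obtain u v where uv: "e = {u, v}" "u \<in> A2 \<union> B \<union> X" "v \<in> A2 \<union> B \<union> X" "u \<noteq> v"
      by (rule complete_onE)
    then consider "u \<in> A2 \<union> X" "v \<in> A2 \<union> X" | "u \<in> B \<union> X" "v \<in> B \<union> X"
      | "u \<in> A2" "v \<in> B" | "v \<in> A2" "u \<in> B" by blast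
    then show "e \<in> complete_on (A2 \<union> X) \<union> complete_on (B \<union> X) \<union> join_edges A2 B"
      using uv(1,4) unfolding complete_on_def join_edges_def
      by cases (blast, blast, blast, use insert_commute in blast)
  next
    fix e assume "e \<in> complete_on (A2 \<union> X) \<union> complete_on (B \<union> X) \<union> join_edges A2 B"
    then show "e \<in> complete_on (A2 \<union> B \<union> X)"
      using A2(5) unfolding complete_on_def join_edges_def by blast
  qed
  show ?case using ordered_product_Un[OF 1 2 3, unfolded id_comp] unfolding 4 .
qed

section \<open>All permutations of the right sign\<close>

text \<open>The identity is an even permutation, so it can only occur as a product of all transpositions if
  \<open>n\<close> is congruent to 0 or 1 modulo 4, the case covered by the block construction.\<close>

lemma even_choose_two_imp:
  assumes "even (n choose 2)"
  obtains k r where "n = 4 * k + r" "r \<le> 1"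
proof -
  have n: "n = 4 * (n div 4) + n mod 4" by simp
  define k where "k = n div 4"
  have "n mod 4 < 4" by simp
  then consider "n mod 4 \<le> 1" | "n = 4 * k + 2" | "n = 4 * k + 3"
    using n unfolding k_def by linarith
  then show thesis
  proof cases
    case 1
    then show thesis using that n by blast
  next
    case 2
    then have "n choose 2 = (2 * k + 1) * (4 * k + 1)"
      by (simp add: choose_two algebra_simps)
    then show thesis using assms by simp
  next
    case 3
    then have "n choose 2 = (4 * k + 3) * (2 * k + 1)"
      by (simp add: choose_two algebra_simps)
    then show thesis using assms by simp
  qed
qed

text \<open>If \<open>p\<close> moves \<open>x\<close> to \<open>y\<close>, run through the star at \<open>x\<close> last, and begin it with the edge from \<open>x\<close>
  to \<open>y\<close>. The star then also carries \<open>x\<close> to \<open>y\<close>, so what it leaves to be produced before it is a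
  permutation fixing \<open>x\<close>, of the right sign, which is a product of the transpositions avoiding \<open>x\<close>
  by induction. Only the identity has no moved point, and it needs the separate construction.\<close>

lemma ordered_product_complete:
  assumes "finite V" "p permutes V" "sign p = (-1) ^ (card V choose 2)"
  shows "ordered_product (complete_on V) p"
  using assms
proof (induction "card V" arbitrary: V p)
  case 0
  then have "V = {}" "p = id" by auto
  then have "edge_product [] = p" "set [] = complete_on V" by simp_all
  then show ?case unfolding ordered_product_def by (metis distinct.simps(1))
next
  case (Suc n)
  show ?case
  proof (cases "p = id")
    case True
    then have "even (card V choose 2)"
      using Suc.prems(3) by (cases "even (card V choose 2)") simp_all
    then obtain k r where kr: "card V = 4 * k + r" "r \<le> 1" by (rule even_choose_two_imp)
    then obtain A where A: "A \<subseteq> V" "card A = 4 * k"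
      by (metis le_add1 obtain_subset_with_card_n)
    have "finite A" using A Suc.prems(1) finite_subset by blast
    then have "ordered_product (complete_on (A \<union> (V - A))) id"
      using A kr Suc.prems(1) by (intro ordered_product_complete_id) (auto simp: card_Diff_subset)
    then show ?thesis using A True by (simp add: Un_absorb1)
  next
    case False
    then obtain x where x: "p x \<noteq> x" by fastforce
    define y where "y = p x"
    have xV: "x \<in> V" using x Suc.prems(2) permutes_not_in by metis
    then have yV: "y \<in> V" "y \<noteq> x"
      using x Suc.prems(2) by (simp_all add: y_def permutes_in_image)
    define V' where "V' = V - {x}"
    have V': "finite V'" "V = insert x V'" "x \<notin> V'" "card V' = n" "y \<in> V'"
      using Suc xV yV by (auto simp: V'_def)
    obtain ys where ys: "distinct ys" "set ys = V' - {y}"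
      using finite_distinct_list[of "V' - {y}"] V'(1) by auto
    let ?star = "map (\<lambda>a. {x, a}) (y # ys)"
    let ?c = "edge_product ?star"
    have star: "distinct ?star" "set ?star = (\<lambda>a. {x, a}) ` V'"
      using ys V' by (auto simp: distinct_map inj_on_def doubleton_eq_iff)
    have star_sub: "set ?star \<subseteq> complete_on V"
      unfolding star V'(2) using V' by (auto simp: complete_on_insert)
    then have c: "?c permutes V" by (rule edge_product_permutes)
    have "edge_product (map (\<lambda>a. {x, a}) ys) y = y"
      using ys yV by (intro edge_product_fixes) auto
    then have cx: "?c x = y"
      by (simp add: edge_product_Cons edge_transposition_pair)
    have "length (y # ys) = card V'"
      using ys V' by (metis Diff_insert_absorb distinct.simps(2) distinct_card insert_Diff
          insertCI list.simps(15) Diff_iff)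
    then have sc: "sign ?c = (-1) ^ n"
      using sign_edge_product[OF Suc.prems(1) star_sub] V'(4) by (simp only: length_map)
    \<comment> \<open>What remains of \<open>p\<close> once the star is split off.\<close>
    define q where "q = inv ?c \<circ> p"
    have qV: "q permutes V"
      unfolding q_def using Suc.prems(2) c by (intro permutes_compose permutes_inv)
    have "q x = x"
      using cx permutes_inv_eq[OF c, of y x] by (simp add: q_def y_def)
    then have q: "q permutes V'"
      using V'(2) by (intro permutes_superset[OF qV]) auto
    have perm: "permutation ?c" "permutation p"
      using c Suc.prems permutation_permutes by blast+
    then have "sign q = sign ?c * sign p"
      unfolding q_def by (subst sign_compose) (simp_all only: permutation_inverse sign_inverse)
    also have "\<dots> = (-1) ^ n * (-1) ^ (card V choose 2)"
      unfolding sc Suc.prems(3) ..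
    also have "card V choose 2 = n + (n choose 2)"
      unfolding Suc.hyps(2)[symmetric] by (simp add: numeral_2_eq_2)
    finally have "sign q = (-1) ^ (card V' choose 2)"
      using V'(4) by (simp add: power_add flip: mult.assoc power_mult_distrib)
    from Suc.hyps(1)[OF V'(4)[symmetric] V'(1) q this]
    have "ordered_product (complete_on V') q" .
    moreover have "ordered_product (set ?star) ?c"
      using star(1) unfolding ordered_product_def by blast
    moreover have "complete_on V' \<inter> set ?star = {}"
      unfolding star complete_on_def using V'(3) by (auto simp: doubleton_eq_iff)
    ultimately have "ordered_product (complete_on V' \<union> set ?star) (?c \<circ> q)"
      by (rule ordered_product_Un)
    moreover have "complete_on V' \<union> set ?star = complete_on V"
      unfolding star V'(2) using V'(3) by (simp add: complete_on_insert Un_commute)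
    moreover have "?c \<circ> q = p"
      unfolding q_def comp_assoc[symmetric] permutes_inv_o(1)[OF c] by (rule id_comp)
    ultimately show ?thesis by simp
  qed
qed

section \<open>Number of cycles and sign\<close>

text \<open>The number of values of a function depends only on which arguments it identifies. This compares
  orbits of different permutations, and orbits with connected components.\<close>

lemma card_image_cong:
  assumes "\<And>x y. x \<in> A \<Longrightarrow> y \<in> A \<Longrightarrow> f x = f y \<longleftrightarrow> g x = g y"
  shows "card (f ` A) = card (g ` A)"
proof -
  define h where "h c = g (SOME x. x \<in> A \<and> f x = c)" for c
  have h: "h (f x) = g x" if "x \<in> A" for x
  proof -
    have "\<exists>y. y \<in> A \<and> f y = f x" using that by blast
    from someI_ex[OF this] show ?thesis using assms that unfolding h_def by blast
  qed
  have "bij_betw h (f ` A) (g ` A)"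
  proof (rule bij_betwI')
    show "h c = h d \<longleftrightarrow> c = d" if "c \<in> f ` A" "d \<in> f ` A" for c d
      using that h assms by fastforce
  qed (use h in auto)
  then show ?thesis by (rule bij_betw_same_card)
qed

lemma orbit_eq_iff_mem:
  assumes "finite S" "p permutes S"
  shows "orbit p x = orbit p y \<longleftrightarrow> y \<in> orbit p x"
proof -
  have "permutation p" using assms permutation_permutes by blast
  then have "x \<in> orbit p x" "y \<in> orbit p y" by (rule permutation_self_in_orbit)+
  then show ?thesis using orbit_cyclic_eq3 cyclic_on_orbit[OF assms(2,1)] by metis
qed

text \<open>Composing with the transposition of a fixed point \<open>x\<close> and \<open>y\<close> inserts \<open>x\<close> into the cycle of \<open>y\<close>,
  directly before \<open>y\<close>; the other cycles are unaffected.\<close>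

lemma card_orbits_insert:
  assumes S: "finite S" and q: "q permutes S" and x: "x \<notin> S" and y: "y \<in> S"
  shows "card (orbit (transposition x y \<circ> q) ` insert x S) = card (orbit q ` S)"
proof -
  define p where "p = transposition x y \<circ> q"
  have p: "p permutes insert x S"
    unfolding p_def using q y
    by (intro permutes_compose permutes_swap_id) (auto intro: permutes_subset)
  have px: "p x = y"
    using permutes_not_in[OF q x] by (simp add: p_def)
  have yx: "y \<in> orbit p x" using orbit.base[of p x] px by simp
  have eq: "orbit p u = orbit p v \<longleftrightarrow> v \<in> orbit p u" for u v
    using orbit_eq_iff_mem[OF _ p] S by simp
  have p_step: "q u = (if p u = x then p (p u) else p u)" if "u \<in> S" for u
    using that x permutes_in_image[OF q] px
    by (auto simp: p_def Transposition.transpose_def permutes_not_in[OF q x])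
  \<comment> \<open>Skipping \<open>x\<close> turns a walk along \<open>p\<close> into a walk along \<open>q\<close>.\<close>
  have fwd: "(if v = x then y else v) \<in> orbit q u" if "v \<in> orbit p u" "u \<in> S" for u v
    using that(1)
  proof (induction rule: orbit.induct)
    case base
    then show ?case using p_step[OF \<open>u \<in> S\<close>] orbit.base[of q u] px by (auto split: if_splits)
  next
    case (step v)
    show ?case
    proof (cases "v = x")
      case True
      then show ?thesis using step px y x by auto
    next
      case False
      then have v: "v \<in> orbit q u" using step by simp
      then have "v \<in> S" using permutes_orbit_subset[OF q that(2)] by blast
      then show ?thesis using p_step[of v] orbit.step[OF v] px by (auto split: if_splits)
    qed
  qed
  have bwd: "v \<in> orbit p u" if "v \<in> orbit q u" "u \<in> S" for u v
    using that(1)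
  proof (induction rule: orbit.induct)
    case base
    show ?case unfolding p_step[OF that(2)] by (auto intro: orbit.intros)
  next
    case (step v)
    then have "v \<in> S" using permutes_orbit_subset[OF q that(2)] by blast
    from p_step[OF this] show ?case using step by (auto intro: orbit.intros)
  qed
  have "orbit p ` insert x S = orbit p ` S"
    using yx eq[of x y] y by auto
  moreover have "card (orbit p ` S) = card (orbit q ` S)"
  proof (rule card_image_cong)
    fix u v assume "u \<in> S" "v \<in> S"
    then have "v \<in> orbit p u \<longleftrightarrow> v \<in> orbit q u"
      using fwd[of v u] bwd[of v u] x by (cases "v = x") auto
    then show "orbit p u = orbit p v \<longleftrightarrow> orbit q u = orbit q v"
      unfolding eq orbit_eq_iff_mem[OF S q] .
  qed
  ultimately show ?thesis by (simp add: p_def)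
qed

lemma card_orbits_id: "card (orbit id ` S) = card S"
proof -
  have "orbit id x = {x}" for x :: 'a by (simp add: orbit_eq_singleton_iff)
  then show ?thesis by (simp add: card_image)
qed

text \<open>Every permutation arises from an identity by inserting points one after the other into existing
  cycles. Each insertion adds a point, keeps the number of cycles, and changes the sign.\<close>

lemma sign_card_orbits:
  assumes "finite S" "p permutes S"
  shows "sign p = (-1) ^ (card S + card (orbit p ` S))"
  using assms
proof (induction "card S" arbitrary: S p)
  case 0
  then show ?case by simp
next
  case (Suc n)
  show ?case
  proof (cases "p = id")
    case True
    then show ?thesis by (simp only: card_orbits_id sign_id) simp
  next
    case False
    then obtain x where x: "p x \<noteq> x" by fastforce
    define y where "y = p x"
    define q where "q = transposition x y \<circ> p"
    define T where "T = S - {x}"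
    have xS: "x \<in> S" using x Suc.prems(2) permutes_not_in by metis
    then have yS: "y \<in> S" "y \<noteq> x"
      using x Suc.prems(2) by (simp_all add: y_def permutes_in_image)
    have T: "finite T" "S = insert x T" "x \<notin> T" "card T = n" "y \<in> T"
      using Suc xS yS by (auto simp: T_def)
    have "q permutes S"
      unfolding q_def using Suc.prems(2) xS yS by (intro permutes_compose permutes_swap_id)
    moreover have "q x = x" by (simp add: q_def y_def)
    ultimately have q: "q permutes T"
      using T(2) by (intro permutes_superset[of q S T]) auto
    have p: "p = transposition x y \<circ> q" by (simp add: q_def fun_eq_iff)
    have "permutation q" using q T(1) permutation_permutes by blast
    then have "sign p = sign (transposition x y) * sign q"
      unfolding p by (intro sign_compose permutation_swap_id)
    also have "\<dots> = - sign q" using yS by (simp add: sign_swap_id)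
    also have "\<dots> = - ((-1) ^ (n + card (orbit q ` T)))"
      using Suc.hyps(1)[OF T(4)[symmetric] T(1) q] T(4) by simp
    also have "card (orbit q ` T) = card (orbit p ` S)"
      unfolding p T(2) by (rule card_orbits_insert[symmetric, OF T(1) q T(3,5)])
    finally show ?thesis using Suc.hyps(2)[symmetric] by simp
  qed
qed

text \<open>Starting from \<open>b\<close> fixed points, the remaining points are inserted into the cycle of 1.\<close>

lemma exists_permutation_card_orbits:
  assumes "1 \<le> b" "b \<le> n"
  shows "\<exists>p. p permutes {1..n} \<and> card (orbit p ` {1..n}) = b"
  using assms(2)
proof (induction n rule: dec_induct)
  case base
  show ?case using permutes_id card_orbits_id by (metis card_atLeastAtMost diff_Suc_1)
next
  case (step n)
  then obtain q where q: "q permutes {1..n}" "card (orbit q ` {1..n}) = b" by blast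
  let ?p = "transposition (Suc n) 1 \<circ> q"
  have "?p permutes {1..Suc n}"
    using q(1) by (intro permutes_compose permutes_swap_id) (auto intro: permutes_subset)
  moreover have "insert (Suc n) {1..n} = {1..Suc n}" by auto
  moreover have "card (orbit ?p ` insert (Suc n) {1..n}) = card (orbit q ` {1..n})"
    using q(1) step assms(1) by (intro card_orbits_insert) auto
  ultimately show ?case using q(2) by metis
qed

section \<open>From orders of the edges to labelings\<close>

lemma monodromy_eq_edge_product:
  "monodromy E l = edge_product (map (inv_into E l) [1..<Suc (card E)])"
  unfolding monodromy_def edge_product_def fold_map by (simp add: comp_def)

lemma exists_labeling:
  assumes "ordered_product E p"
  shows "\<exists>l. edge_labeling E l \<and> monodromy E l = p"
proof -
  obtain xs where xs: "distinct xs" "set xs = E" "edge_product xs = p"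
    using assms unfolding ordered_product_def by blast
  define m where "m = card E"
  have m: "length xs = m" using xs distinct_card m_def by metis
  define g where "g i = xs ! (i - 1)" for i
  define l where "l = inv_into {1..m} g"
  have "bij_betw (\<lambda>i. i - 1) {1..m} {..<m}"
    by (rule bij_betw_byWitness[where f' = Suc]) auto
  from bij_betw_trans[OF this bij_betw_nth[OF xs(1)]] have g: "bij_betw g {1..m} E"
    using m xs(2) unfolding g_def[abs_def] comp_def by simp
  then have l: "bij_betw l E {1..m}" unfolding l_def by (rule bij_betw_inv_into)
  have inv: "inv_into E l i = g i" if "i \<in> {1..m}" for i
    using that g l unfolding l_def
    by (metis bij_betw_def bij_betw_inv_into_left inv_into_f_f imageI)
  have "map (inv_into E l) [1..<Suc m] = xs"
    using m by (intro nth_equalityI) (auto simp: inv g_def simp del: upt_Suc)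
  then have "monodromy E l = p"
    using xs(3) unfolding monodromy_eq_edge_product m_def by simp
  then show ?thesis using l unfolding edge_labeling_def m_def by blast
qed

section \<open>The boundary of the half disc\<close>

text \<open>The diameter is the straight part of the boundary of the half disc, with the vertex in its middle.\<close>

definition diameter :: "complex set" where
  "diameter = complex_of_real ` {-1..1}"

text \<open>With \<open>d\<close> half-edges, the ends of the ribbons divide the half circle at multiples of this angle: in
  these units the half circle has length \<open>4 * (d + 1)\<close> and the end of the \<open>r\<close>-th ribbon is the interval
  from \<open>4 * r - 1\<close> to \<open>4 * r + 1\<close>.\<close>

definition angle_step :: "nat \<Rightarrow> real" where
  "angle_step d = pi / (4 * (real d + 1))"

definition ribbon_point :: "nat \<Rightarrow> nat \<Rightarrow> real \<Rightarrow> complex" where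
  "ribbon_point d r s = cis ((4 * real r + s) * angle_step d)"

text \<open>The gaps are the closed arcs complementary to the ends of the ribbons; the \<open>k\<close>-th gap follows the
  \<open>k\<close>-th ribbon. The first gap starts and the last gap stops at an end of the diameter.\<close>

definition gap_start :: "nat \<Rightarrow> nat \<Rightarrow> real" where
  "gap_start d k = (if k = 0 then 0 else (4 * real k + 1) * angle_step d)"

definition gap_end :: "nat \<Rightarrow> nat \<Rightarrow> real" where
  "gap_end d k = (if k = d then pi else (4 * real k + 3) * angle_step d)"

definition gap :: "nat \<Rightarrow> nat \<Rightarrow> complex set" where
  "gap d k = cis ` {gap_start d k..gap_end d k}"

lemma angle_step_pos: "angle_step d > 0"
  by (simp add: angle_step_def)

lemma pi_eq_steps: "pi = 4 * (real d + 1) * angle_step d"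
  by (simp add: angle_step_def field_simps)

lemma step_mult_le_iff: "x * angle_step d \<le> y * angle_step d \<longleftrightarrow> x \<le> y"
  by (rule mult_le_cancel_right_pos[OF angle_step_pos])

lemma step_mult_le_pi_iff: "x * angle_step d \<le> pi \<longleftrightarrow> x \<le> 4 * (real d + 1)"
  by (subst pi_eq_steps[of d]) (rule step_mult_le_iff)

lemma pi_le_step_mult_iff: "pi \<le> x * angle_step d \<longleftrightarrow> 4 * (real d + 1) \<le> x"
  by (subst pi_eq_steps[of d]) (rule step_mult_le_iff)

lemma step_mult_nonneg_iff: "0 \<le> x * angle_step d \<longleftrightarrow> 0 \<le> x"
  using step_mult_le_iff[of 0 d x] by simp

lemma step_mult_nonpos_iff: "x * angle_step d \<le> 0 \<longleftrightarrow> x \<le> 0"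
  using step_mult_le_iff[of x d 0] by simp

lemma cis_eq_upper:
  assumes "cis x = cis y" "x \<in> {0..pi}" "y \<in> {0..pi}"
  shows "x = y"
  using assms cos_inj_pi[of x y] by (simp add: complex_eq_iff)

lemma gap_start_le_end:
  assumes "k \<le> d"
  shows "gap_start d k \<le> gap_end d k"
proof -
  have "k = d \<or> real k + 1 \<le> real d" using assms by linarith
  then show ?thesis
    unfolding gap_start_def gap_end_def using assms
    by (auto simp: step_mult_le_iff step_mult_le_pi_iff step_mult_nonneg_iff)
qed

lemma gap_interval_subset:
  assumes "k \<le> d"
  shows "{gap_start d k..gap_end d k} \<subseteq> {0..pi}"
proof -
  have "k = d \<or> real k + 1 \<le> real d" using assms by linarith
  then have "gap_end d k \<le> pi" "0 \<le> gap_start d k"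
    unfolding gap_start_def gap_end_def
    by (auto simp: step_mult_le_iff step_mult_le_pi_iff step_mult_nonneg_iff)
  then show ?thesis by auto
qed

lemma gap_start_in: "k \<le> d \<Longrightarrow> cis (gap_start d k) \<in> gap d k"
  and gap_end_in: "k \<le> d \<Longrightarrow> cis (gap_end d k) \<in> gap d k"
  using gap_start_le_end[of k d] by (auto simp: gap_def)

lemma ribbon_angle_range:
  assumes "1 \<le> r" "r \<le> d" "-1 \<le> s" "s \<le> 1"
  shows "0 < (4 * real r + s) * angle_step d"
    and "(4 * real r + s) * angle_step d < pi"
proof -
  have "\<not> 4 * real r + s \<le> 0" "\<not> 4 * (real d + 1) \<le> 4 * real r + s" using assms by auto
  then show "0 < (4 * real r + s) * angle_step d"
    and "(4 * real r + s) * angle_step d < pi"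
    by (simp_all only: not_le[symmetric] step_mult_nonpos_iff pi_le_step_mult_iff simp_thms)
qed

lemma cis_in_gap_iff:
  assumes "k \<le> d" "x \<in> {0..pi}"
  shows "cis x \<in> gap d k \<longleftrightarrow> x \<in> {gap_start d k..gap_end d k}"
proof
  assume "cis x \<in> gap d k"
  then obtain y where "cis x = cis y" "y \<in> {gap_start d k..gap_end d k}"
    by (auto simp: gap_def)
  moreover from this have "x = y"
    using gap_interval_subset[OF assms(1)] assms(2) by (intro cis_eq_upper) auto
  ultimately show "x \<in> {gap_start d k..gap_end d k}" by simp
qed (simp add: gap_def)

lemma cis_in_diameter_iff:
  assumes "x \<in> {0..pi}"
  shows "cis x \<in> diameter \<longleftrightarrow> x = 0 \<or> x = pi"
proof
  assume "cis x \<in> diameter"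
  then have "sin x = 0" by (auto simp: diameter_def complex_eq_iff)
  then show "x = 0 \<or> x = pi"
    using assms sin_gt_zero[of x] by (force simp: less_le)
next
  assume "x = 0 \<or> x = pi"
  then have "cis x = complex_of_real (cos x)" by auto
  then show "cis x \<in> diameter" unfolding diameter_def by auto
qed

lemma gap_disjoint:
  assumes "k \<le> d" "j \<le> d" "z \<in> gap d k" "z \<in> gap d j"
  shows "k = j"
proof -
  have less: False if kj: "k < j" "j \<le> d" and z: "z \<in> gap d k" "z \<in> gap d j" for k j
  proof -
    obtain x where x: "z = cis x" "x \<in> {gap_start d k..gap_end d k}"
      using z(1) by (auto simp: gap_def)
    have "k \<le> d" using kj by simp
    then have "x \<in> {gap_start d j..gap_end d j}"
      using x z kj cis_in_gap_iff[of j d x] gap_interval_subset[of k d] by blast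
    then have "gap_start d j \<le> gap_end d k" using x by simp
    then have "4 * real j + 1 \<le> 4 * real k + 3"
      using kj unfolding gap_start_def gap_end_def
      by (auto simp: step_mult_le_iff)
    then show False using kj(1) by linarith
  qed
  show ?thesis
    using less[of k j] less[of j k] assms by (meson linorder_neqE_nat)
qed

lemma gap_meets_diameter:
  assumes "k \<le> d" "z \<in> gap d k" "z \<in> diameter"
  shows "k = 0 \<or> k = d"
proof -
  obtain x where x: "z = cis x" "x \<in> {gap_start d k..gap_end d k}"
    using assms(2) by (auto simp: gap_def)
  have "x \<in> {0..pi}" using x gap_interval_subset[OF assms(1)] by blast
  then have "x = 0 \<or> x = pi" using cis_in_diameter_iff assms(3) x(1) by blast
  then show ?thesis
  proof
    assume "x = 0"
    then have "gap_start d k \<le> 0" using x by simp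
    then show ?thesis
      by (auto simp: gap_start_def step_mult_nonpos_iff split: if_splits)
  next
    assume "x = pi"
    then have le: "pi \<le> gap_end d k" using x by simp
    show ?thesis
    proof (rule ccontr)
      assume ne: "\<not> (k = 0 \<or> k = d)"
      then have "4 * (real d + 1) \<le> 4 * real k + 3"
        using le by (simp add: gap_end_def pi_le_step_mult_iff)
      moreover have "real k \<le> real d" using assms(1) by simp
      ultimately show False by argo
    qed
  qed
qed

text \<open>A gap meets the end of a ribbon only in an end point: the \<open>r\<close>-th ribbon separates the gap \<open>r - 1\<close>
  from the gap \<open>r\<close>.\<close>

lemma ribbon_point_in_gap:
  assumes "1 \<le> r" "r \<le> d" "k \<le> d" "-1 \<le> s" "s \<le> 1" "ribbon_point d r s \<in> gap d k"
  shows "k = r \<and> s = 1 \<or> Suc k = r \<and> s = -1"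
proof -
  let ?x = "(4 * real r + s) * angle_step d"
  have "?x \<in> {0..pi}" using ribbon_angle_range[OF assms(1,2,4,5)] by simp
  then have x: "gap_start d k \<le> ?x" "?x \<le> gap_end d k"
    using cis_in_gap_iff[OF assms(3)] assms(6) by (auto simp: ribbon_point_def)
  show ?thesis
  proof (cases "r \<le> k")
    case True
    then have "4 * real k + 1 \<le> 4 * real r + s"
      using x(1) assms(1) by (simp add: gap_start_def step_mult_le_iff)
    then have "k \<le> r" using assms(5) by linarith
    then show ?thesis using True assms(5) \<open>4 * real k + 1 \<le> 4 * real r + s\<close> by auto
  next
    case False
    then have le: "4 * real r + s \<le> 4 * real k + 3"
      using x(2) assms(2) by (simp add: gap_end_def step_mult_le_iff)
    then have "r \<le> Suc k" using assms(4) by linarith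
    then have "r = Suc k" using False by simp
    then show ?thesis using le assms(4) by auto
  qed
qed

lemma ribbon_point_notin_diameter:
  assumes "1 \<le> r" "r \<le> d" "-1 \<le> s" "s \<le> 1"
  shows "ribbon_point d r s \<notin> diameter"
  using ribbon_angle_range[OF assms] unfolding ribbon_point_def
  by (subst cis_in_diameter_iff) auto

lemma ribbon_point_last_in_gap:
  assumes "1 \<le> k" "k \<le> d"
  shows "ribbon_point d k 1 \<in> gap d k"
  using gap_start_in[OF assms(2)] assms(1) by (simp add: gap_start_def ribbon_point_def)

lemma ribbon_point_first_in_gap:
  assumes "k < d"
  shows "ribbon_point d (Suc k) (-1) \<in> gap d k"
  using gap_end_in[of k d] assms by (simp add: gap_end_def ribbon_point_def algebra_simps)

lemma one_in_gap: "1 \<in> gap d 0"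
  using gap_start_in[of 0 d] by (simp add: gap_start_def)

lemma minus_one_in_gap: "-1 \<in> gap d d"
  using gap_end_in[of d d] by (simp add: gap_end_def)

text \<open>The relevant gap is the last one that starts at or before the point. If the point were beyond the
  end of that gap, it would lie inside the next ribbon.\<close>

lemma gap_cover:
  assumes x: "x \<in> {0..pi}"
    and avoid: "\<And>r s. \<lbrakk>1 \<le> r; r \<le> d; -1 < s; s < 1\<rbrakk> \<Longrightarrow> cis x \<noteq> ribbon_point d r s"
  obtains k where "k \<le> d" "cis x \<in> gap d k"
proof -
  define h where "h = angle_step d"
  have h: "h > 0" by (simp add: h_def angle_step_pos)
  define K where "K = {k. k \<le> d \<and> gap_start d k \<le> x}"
  have K: "finite K" "0 \<in> K" using x by (auto simp: K_def gap_start_def)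
  define k where "k = Max K"
  have kK: "k \<le> d" "gap_start d k \<le> x" using Max_in[of K] K unfolding k_def K_def by blast+
  have "x \<le> gap_end d k"
  proof (rule ccontr)
    assume "\<not> x \<le> gap_end d k"
    then have gt: "gap_end d k < x" by simp
    have "k \<noteq> d" using gt x by (auto simp: gap_end_def)
    then have kd: "Suc k \<le> d" using kK by simp
    have "Suc k \<notin> K" using Max_ge[OF K(1), of "Suc k"] by (auto simp: k_def)
    then have lt: "x < (4 * real k + 5) * h"
      using kd by (auto simp: K_def gap_start_def h_def algebra_simps)
    have gt': "(4 * real k + 3) * h < x"
      using gt \<open>k \<noteq> d\<close> by (simp add: gap_end_def h_def)
    define s where "s = x / h - 4 * real (Suc k)"
    have "x = (4 * real (Suc k) + s) * h" using h by (simp add: s_def)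
    then have "cis x = ribbon_point d (Suc k) s" by (simp add: ribbon_point_def h_def)
    moreover have "-1 < s" "s < 1"
      using lt gt' h by (auto simp: s_def field_simps)
    ultimately show False using avoid[of "Suc k" s] kd by simp
  qed
  then show thesis using that[OF kK(1)] cis_in_gap_iff[OF kK(1) x] kK(2) by simp
qed

lemma half_disc_eq: "half_disc = cball 0 1 \<inter> {z. 0 \<le> Im z}"
  by (auto simp: half_disc_def)

lemma interior_halfspace_Im: "interior {z. 0 \<le> Im z} = {z. 0 < Im z}"
proof -
  have "interior {x. \<i> \<bullet> x \<ge> 0} = {x. \<i> \<bullet> x > 0}"
    by (rule interior_halfspace_ge) simp
  then show ?thesis by (simp add: inner_complex_def)
qed

lemma frontier_half_disc: "frontier half_disc = diameter \<union> cis ` {0..pi}"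
proof -
  have "closed half_disc"
    unfolding half_disc_eq by (intro closed_Int closed_cball closed_halfspace_Im_ge)
  then have "frontier half_disc = half_disc - (ball 0 1 \<inter> {z. 0 < Im z})"
    unfolding frontier_def half_disc_eq interior_Int interior_halfspace_Im by simp
  also have "\<dots> = diameter \<union> cis ` {0..pi}"
  proof (intro set_eqI iffI)
    fix z assume z: "z \<in> half_disc - (ball 0 1 \<inter> {z. 0 < Im z})"
    show "z \<in> diameter \<union> cis ` {0..pi}"
    proof (cases "Im z = 0")
      case True
      then have "z = complex_of_real (Re z)" "\<bar>Re z\<bar> \<le> 1"
        using z abs_Re_le_cmod[of z] by (auto simp: complex_eq_iff half_disc_def)
      then show ?thesis unfolding diameter_def by (metis UnI1 abs_le_iff atLeastAtMost_iff image_eqI minus_le_iff)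
    next
      case False
      then have "cmod z = 1" "0 \<le> Im z" "z \<noteq> 0" using z by (auto simp: half_disc_def)
      then have "z = cis (Arg z)" "0 \<le> Arg z" "Arg z \<le> pi"
        using cis_Arg[of z] Arg_bounded[of z] Arg_less_0[of z]
        by (auto simp: sgn_div_norm)
      then show ?thesis by (metis UnI2 atLeastAtMost_iff image_eqI)
    qed
  next
    fix z assume "z \<in> diameter \<union> cis ` {0..pi}"
    then show "z \<in> half_disc - (ball 0 1 \<inter> {z. 0 < Im z})"
      by (auto simp: diameter_def half_disc_def sin_ge_zero)
  qed
  finally show ?thesis .
qed

lemma gap_subset_frontier: "k \<le> d \<Longrightarrow> gap d k \<subseteq> frontier half_disc"
  using gap_interval_subset unfolding frontier_half_disc gap_def by blast

lemma compact_gap: "compact (gap d k)"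
  unfolding gap_def by (intro compact_continuous_image continuous_intros) auto

lemma connected_gap: "connected (gap d k)"
  unfolding gap_def by (intro connected_continuous_image continuous_intros) auto

lemma compact_diameter: "compact diameter"
  unfolding diameter_def by (intro compact_continuous_image continuous_intros) auto

lemma connected_diameter: "connected diameter"
  unfolding diameter_def by (intro connected_continuous_image continuous_intros) auto

lemma frontier_half_disc_subset: "frontier half_disc \<subseteq> half_disc"
  unfolding frontier_half_disc by (auto simp: diameter_def half_disc_def sin_ge_zero)

section \<open>Walks along the boundary of the surface\<close>

text \<open>A walker starts at each vertex at time 0. At time \<open>i\<close> the walkers at the two end points of the
  edge labeled \<open>i\<close> change places, so at the end they have carried out the monodromy. These walks are
  the combinatorial trace of the boundary of the surface.\<close>

locale labeled_graph =
  fixes V :: "nat set" and E :: "nat set set" and l :: "nat set \<Rightarrow> nat"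
  assumes finite_V: "finite V"
    and edges: "E \<subseteq> complete_on V"
    and labeling: "edge_labeling E l"
begin

definition edge :: "nat \<Rightarrow> nat set" where
  "edge i = inv_into E l i"

definition position :: "nat \<Rightarrow> nat \<Rightarrow> nat" where
  "position i = edge_product (map edge [1..<Suc i])"

text \<open>At time \<open>i\<close> the edges at \<open>v\<close> with label at most \<open>i\<close> have been used. The walker who is then at
  \<open>v\<close> runs along the gap that follows the last of these edges and precedes the next one.\<close>

definition passed :: "nat \<Rightarrow> nat \<Rightarrow> nat" where
  "passed v i = card {e \<in> incident_edges E v. l e \<le> i}"

definition degree :: "nat \<Rightarrow> nat" where
  "degree v = card (incident_edges E v)"

lemma finite_E: "finite E"
proof -
  have "E \<subseteq> Pow V" using edges unfolding complete_on_def by auto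
  then show ?thesis using finite_V finite_subset by blast
qed

lemma finite_incident: "finite (incident_edges E v)"
  using finite_E by (simp add: incident_edges_def)

lemma bij_l: "bij_betw l E {1..card E}"
  using labeling by (simp add: edge_labeling_def)

lemma label_range:
  assumes "e \<in> E" shows "1 \<le> l e" "l e \<le> card E"
  using bij_betwE[OF bij_l] assms by auto

lemma edge_in: "\<lbrakk>1 \<le> i; i \<le> card E\<rbrakk> \<Longrightarrow> edge i \<in> E"
  using bij_betwE[OF bij_betw_inv_into[OF bij_l]] by (auto simp: edge_def)

lemma label_edge: "\<lbrakk>1 \<le> i; i \<le> card E\<rbrakk> \<Longrightarrow> l (edge i) = i"
  unfolding edge_def by (rule bij_betw_inv_into_right[OF bij_l]) simp

lemma edge_label: "e \<in> E \<Longrightarrow> edge (l e) = e"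
  unfolding edge_def by (rule bij_betw_inv_into_left[OF bij_l])

lemma position_0 [simp]: "position 0 v = v"
  by (simp add: position_def)

lemma position_Suc: "position (Suc i) v = edge_transposition (edge (Suc i)) (position i v)"
proof -
  have "[1..<Suc (Suc i)] = [1..<Suc i] @ [Suc i]" by simp
  then show ?thesis unfolding position_def by (simp only: map_append edge_product_append)
      (simp add: edge_product_snoc[of "[]", simplified])
qed

lemma position_permutes: "i \<le> card E \<Longrightarrow> position i permutes V"
  unfolding position_def using edges edge_in by (intro edge_product_permutes) force

lemma monodromy_eq_position: "monodromy E l = position (card E)"
  unfolding position_def edge_def[abs_def] by (rule monodromy_eq_edge_product)

lemma passed_mono: "i \<le> j \<Longrightarrow> passed v i \<le> passed v j"
  unfolding passed_def using finite_incident by (intro card_mono) auto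

lemma passed_le_degree: "passed v i \<le> degree v"
  unfolding passed_def degree_def using finite_incident by (intro card_mono) auto

lemma passed_0: "passed v 0 = 0"
proof -
  have "{e \<in> incident_edges E v. l e \<le> 0} = {}"
    using label_range by (fastforce simp: incident_edges_def)
  then show ?thesis unfolding passed_def by (metis card.empty)
qed

lemma passed_last: "passed v (card E) = degree v"
proof -
  have "{e \<in> incident_edges E v. l e \<le> card E} = incident_edges E v"
    using label_range by (auto simp: incident_edges_def)
  then show ?thesis by (simp add: passed_def degree_def)
qed

lemma passed_Suc:
  assumes "i < card E"
  shows "passed v (Suc i) = (if v \<in> edge (Suc i) then Suc (passed v i) else passed v i)"
proof -
  have e: "edge (Suc i) \<in> E" "l (edge (Suc i)) = Suc i"
    using assms edge_in[of "Suc i"] label_edge[of "Suc i"] by auto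
  have "l f = Suc i \<longleftrightarrow> f = edge (Suc i)" if "f \<in> E" for f
    using edge_label[OF that] e by metis
  then have "{f \<in> incident_edges E v. l f = Suc i} = {f \<in> incident_edges E v. f = edge (Suc i)}"
    by (auto simp: incident_edges_def)
  also have "\<dots> = (if v \<in> edge (Suc i) then {edge (Suc i)} else {})"
    using e(1) by (auto simp: incident_edges_def)
  finally have "{f \<in> incident_edges E v. l f \<le> Suc i} = {f \<in> incident_edges E v. l f \<le> i} \<union>
      (if v \<in> edge (Suc i) then {edge (Suc i)} else {})"
    unfolding le_Suc_eq by blast
  moreover have "edge (Suc i) \<notin> {e \<in> incident_edges E v. l e \<le> i}" using e by simp
  ultimately show ?thesis using finite_incident[of v] unfolding passed_def by simp
qed

lemma edge_rank_eq_passed: "edge_rank E l v e = passed v (l e)"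
  by (simp add: edge_rank_def passed_def)

lemma edge_rank_range:
  assumes "e \<in> incident_edges E v"
  shows "1 \<le> edge_rank E l v e" "edge_rank E l v e \<le> degree v"
proof -
  have "card {f \<in> incident_edges E v. l f \<le> l e} > 0"
    using assms finite_incident[of v] by (auto simp: card_gt_0_iff)
  then show "1 \<le> edge_rank E l v e" by (simp add: edge_rank_def)
  show "edge_rank E l v e \<le> degree v" by (simp add: edge_rank_eq_passed passed_le_degree)
qed

lemma edge_rank_surj:
  assumes "1 \<le> r" "r \<le> degree v"
  obtains e where "e \<in> incident_edges E v" "edge_rank E l v e = r"
proof -
  let ?I = "incident_edges E v" and ?rk = "edge_rank E l v"
  have less: "?rk e < ?rk f" if "e \<in> ?I" "f \<in> ?I" "l e < l f" for e f
  proof -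
    have "f \<in> {g \<in> incident_edges E v. l g \<le> l f}" "f \<notin> {g \<in> incident_edges E v. l g \<le> l e}"
      using that by auto
    moreover have "{g \<in> incident_edges E v. l g \<le> l e} \<subseteq> {g \<in> incident_edges E v. l g \<le> l f}"
      using that by auto
    ultimately show ?thesis
      unfolding edge_rank_def using finite_incident[of v] by (intro psubset_card_mono) auto
  qed
  have "inj_on ?rk ?I"
  proof (rule inj_onI)
    fix e f assume ef: "e \<in> ?I" "f \<in> ?I" "?rk e = ?rk f"
    then have "l e = l f" using less[of e f] less[of f e] by (metis less_irrefl linorder_neqE_nat)
    then show "e = f"
      using ef bij_betw_imp_inj_on[OF bij_l] by (auto simp: incident_edges_def dest: inj_onD)
  qed
  then have "card (?rk ` ?I) = card {1..degree v}" by (simp add: card_image degree_def)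
  moreover have "?rk ` ?I \<subseteq> {1..degree v}" using edge_rank_range by auto
  ultimately have "?rk ` ?I = {1..degree v}" by (intro card_subset_eq) auto
  then show thesis using that assms by (metis atLeastAtMost_iff imageE)
qed

lemma passed_surj:
  assumes "k \<le> degree v"
  obtains i where "i \<le> card E" "passed v i = k"
proof (cases "k = 0")
  case True
  then show thesis using that[of 0] passed_0 by simp
next
  case False
  then obtain e where "e \<in> incident_edges E v" "edge_rank E l v e = k"
    using edge_rank_surj assms by (metis One_nat_def Suc_leI neq0_conv)
  then show thesis
    using that[of "l e"] label_range by (auto simp: edge_rank_eq_passed incident_edges_def)
qed

lemma ribbon_end_eq: "ribbon_end E l v e s = ribbon_point (degree v) (edge_rank E l v e) s"
proof -
  have "r * pi / x + s * (pi / (4 * x)) = (4 * r + s) * (pi / (4 * x))" if "x > 0" for r x :: real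
    using that by (simp add: field_simps)
  from this[of "real (card (incident_edges E v)) + 1"]
show ?thesis
    unfolding ribbon_end_def ribbon_point_def Let_def degree_def angle_step_def by simp
qed

lemma edge_endpoints:
  assumes "e \<in> E"
  obtains a b where "e = {a, b}" "a \<in> V" "b \<in> V" "a \<noteq> b"
  by (rule complete_onE[OF subsetD[OF edges assms]])

lemma edge_transposition_notin:
  assumes "e \<in> E" "v \<notin> e"
  shows "edge_transposition e v = v"
proof -
  obtain a b where "e = {a, b}" using edge_endpoints[OF assms(1)] by blast
  then show ?thesis using assms(2) by (simp add: edge_transposition_pair)
qed

text \<open>As long as no edge at \<open>v\<close> is used, whoever is at \<open>v\<close> stays there.\<close>

lemma position_stays:
  assumes "i \<le> j" "j \<le> card E" "passed v i = passed v j"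
  shows "position i u = v \<longleftrightarrow> position j u = v"
  using assms
proof (induction j rule: dec_induct)
  case base
  show ?case ..
next
  case (step j)
  have j: "passed v j = passed v i" "passed v (Suc j) = passed v j"
    using step passed_mono[of i j v] passed_mono[of j "Suc j" v] by auto
  then have e: "edge (Suc j) \<in> E" "v \<notin> edge (Suc j)"
    using passed_Suc[of j v] edge_in[of "Suc j"] step.prems by (auto split: if_splits)
  obtain a b where ab: "edge (Suc j) = {a, b}" using edge_endpoints[OF e(1)] by blast
  have "position i u = v \<longleftrightarrow> position j u = v"
    using step.prems(1) j(1) by (intro step.IH) simp_all
  also have "\<dots> \<longleftrightarrow> position (Suc j) u = v"
    using e(2) unfolding position_Suc ab edge_transposition_pair
    by (simp add: Transposition.transpose_def)
  finally show ?case .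
qed

text \<open>A gap determines its walker: different times belonging to the same gap at \<open>v\<close> differ by edges that
  avoid \<open>v\<close>.\<close>

lemma position_unique:
  assumes "i \<le> card E" "j \<le> card E" "position i u = v" "position j u' = v" "passed v i = passed v j"
  shows "u = u'"
proof -
  have *: "u = u'" if "i \<le> j" "j \<le> card E" "position i u = v" "position j u' = v"
    "passed v i = passed v j" for i j u u'
    using position_stays[OF that(1,2,5)] that(3,4) permutes_inj[OF position_permutes[OF that(2)]]
    by (metis injD)
  show ?thesis using *[of i j u u'] *[of j i u' u] assms by (metis nat_le_linear)
qed

text \<open>The part of the boundary traced by the walker who starts at \<open>u\<close>: the diameter at \<open>u\<close>, and all gaps
  along which the walk leads. It ends at the diameter of the image of \<open>u\<close> under the monodromy, where
  the next strand begins.\<close>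

definition strand :: "nat \<Rightarrow> (nat \<times> complex) set" where
  "strand u = {u} \<times> diameter \<union>
     (\<Union>i\<le>card E. {position i u} \<times> gap (degree (position i u)) (passed (position i u) i))"

definition boundary_points :: "(nat \<times> complex) set" where
  "boundary_points = (SIGMA v:V. frontier half_disc -
       (\<Union>e\<in>incident_edges E v. ribbon_end E l v e ` {-1<..<1}))"

lemma strand_gapI:
  assumes "i \<le> card E" "position i u = v" "passed v i = k" "z \<in> gap (degree v) k"
  shows "(v, z) \<in> strand u"
  using assms unfolding strand_def by blast

lemma strand_cases:
  assumes "(v, z) \<in> strand u"
  obtains "v = u" "z \<in> diameter"
  | i where "i \<le> card E" "position i u = v" "z \<in> gap (degree v) (passed v i)"
  using assms unfolding strand_def by auto

text \<open>A common point in two gaps forces the gaps, hence the walkers, to agree. A common point on a gap and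
  on a diameter is one of the two ends of the diameter. At the right end, the walker is still at its
  start; at the left end, it has arrived at its image under the monodromy.\<close>

lemma strand_meet:
  assumes "p \<in> strand u" "p \<in> strand u'"
  shows "orbit (monodromy E l) u = orbit (monodromy E l) u'"
proof -
  have mixed: "orbit (monodromy E l) u = orbit (monodromy E l) v"
    if "i \<le> card E" "position i u = v" "z \<in> gap (degree v) (passed v i)" "z \<in> diameter" for u v z i
    using gap_meets_diameter[OF passed_le_degree that(3,4)]
  proof
    assume "passed v i = 0"
    then have "u = v" using position_unique[of i 0 u v v] that by (simp add: passed_0)
    then show ?thesis by simp
  next
    assume "passed v i = degree v"
    then have "position (card E) u = v"
      using position_stays[of i "card E" v u] that by (simp add: passed_last)
    then show ?thesis
      unfolding monodromy_eq_position
      using orbit_eq_iff_mem[OF finite_V position_permutes] orbit.base[of "position (card E)" u]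
      by simp
  qed
  obtain v z where p: "p = (v, z)" by fastforce
  have 1: "(v, z) \<in> strand u" and 2: "(v, z) \<in> strand u'" using assms p by auto
  show ?thesis
  proof (rule strand_cases[OF 1]; rule strand_cases[OF 2])
    fix i j assume "i \<le> card E" "position i u = v" "z \<in> gap (degree v) (passed v i)"
      "j \<le> card E" "position j u' = v" "z \<in> gap (degree v) (passed v j)"
    moreover from this have "passed v i = passed v j"
      by (intro gap_disjoint[OF passed_le_degree passed_le_degree])
    ultimately show ?thesis using position_unique[of i j u v u'] by simp
  next
    fix j assume "v = u" "z \<in> diameter"
      and "j \<le> card E" "position j u' = v" "z \<in> gap (degree v) (passed v j)"
    then show ?thesis using mixed[of j u' v z] by simp
  next
    fix i assume "i \<le> card E" "position i u = v" "z \<in> gap (degree v) (passed v i)"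
      and "v = u'" "z \<in> diameter"
    then show ?thesis using mixed[of i u v z] by simp
  next
    assume "v = u" "v = u'"
    then show ?thesis by simp
  qed
qed

text \<open>The end of the ribbon of an edge meets the strand only in an end point. If that is the first point
  of the ribbon, the walker is about to use the edge and continues behind the other end of the
  ribbon; the gluing reverses orientation, so that is the last point there. If it is the last point,
  the walker has just used the edge and came from the first point of the other end.\<close>

lemma strand_gluing:
  assumes p: "p \<in> strand u" and pq: "(p, q) \<in> gluing E l"
  shows "q \<in> strand u"
proof -
  from pq obtain v w s where
    pq: "p = (v, ribbon_end E l v {v, w} s)" "q = (w, ribbon_end E l w {v, w} (- s))"
    and e: "{v, w} \<in> E" "v \<noteq> w" and s: "-1 \<le> s" "s \<le> 1"
    unfolding gluing_def by auto
  define j where "j = l {v, w}"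
  have j: "1 \<le> j" "j \<le> card E" "edge j = {v, w}"
    using label_range[OF e(1)] edge_label[OF e(1)] by (auto simp: j_def)
  obtain i' where i': "j = Suc i'" "i' < card E" using j by (cases j) auto
  have step: "position j u = edge_transposition {v, w} (position i' u)" for u
    using position_Suc[of i' u] j(3) i'(1) by simp
  have pv: "passed v j = Suc (passed v i')" and pw: "passed w j = Suc (passed w i')"
    using passed_Suc[OF i'(2)] j(3) i'(1) by auto
  have rv: "edge_rank E l v {v, w} = passed v j" and rw: "edge_rank E l w {v, w} = passed w j"
    by (simp_all add: edge_rank_eq_passed j_def)
  have range: "1 \<le> passed v j" "passed v j \<le> degree v" "1 \<le> passed w j" "passed w j \<le> degree w"
    using pv pw passed_le_degree[of v j] passed_le_degree[of w j] by auto
  have p': "(v, ribbon_point (degree v) (passed v j) s) \<in> strand u"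
    using p pq(1) by (simp add: ribbon_end_eq rv)
  have q: "q = (w, ribbon_point (degree w) (passed w j) (- s))"
    using pq(2) by (simp add: ribbon_end_eq rw)
  from p' show ?thesis
  proof (cases rule: strand_cases)
    case 1
    then show ?thesis using ribbon_point_notin_diameter[OF range(1,2) s] by simp
  next
    case (2 i)
    from ribbon_point_in_gap[OF range(1,2) passed_le_degree s 2(3)]
    show ?thesis
    proof
      assume a: "passed v i = passed v j \<and> s = 1"
      \<comment> \<open>The walker is at \<open>v\<close> just after using the edge.\<close>
      have "position j u = v"
        using position_stays[of i j v u] position_stays[of j i v u] a 2(1,2) j(2)
        by (metis nat_le_linear)
      then have "position i' u = w"
        using step e(2) by (auto simp: edge_transposition_pair Transposition.transpose_def split: if_splits)
      moreover have "ribbon_point (degree w) (passed w j) (-1) \<in> gap (degree w) (passed w i')"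
        using range(4) pw ribbon_point_first_in_gap[of "passed w i'" "degree w"] by simp
      ultimately show ?thesis
        unfolding q using a i'(2) by (intro strand_gapI[of i']) auto
    next
      assume a: "Suc (passed v i) = passed v j \<and> s = -1"
      \<comment> \<open>The walker is at \<open>v\<close> just before using the edge.\<close>
      have "position i' u = v"
        using position_stays[of i i' v u] position_stays[of i' i v u] a pv 2(1,2) i'(2)
        by (metis nat_le_linear less_imp_le Suc_inject)
      then have "position j u = w"
        using step by (simp add: edge_transposition_pair)
      then show ?thesis
        unfolding q using a j(2) ribbon_point_last_in_gap[OF range(3,4)]
        by (intro strand_gapI[of j]) auto
    qed
  qed
qed

lemma strand_gluing_rtrancl:
  assumes "(p, q) \<in> (gluing E l)\<^sup>*" "p \<in> strand u"
  shows "q \<in> strand u"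
  using assms by (induction rule: rtrancl_induct) (auto intro: strand_gluing)

lemma boundary_points_eq: "boundary_points = (\<Union>u\<in>V. strand u)"
proof (intro subset_antisym subsetI)
  fix p assume p: "p \<in> boundary_points"
  obtain v z where vz: "p = (v, z)" by fastforce
  have v: "v \<in> V" and z: "z \<in> diameter \<union> cis ` {0..pi}"
    and avoid: "\<And>e s. \<lbrakk>e \<in> incident_edges E v; -1 < s; s < 1\<rbrakk> \<Longrightarrow> z \<noteq> ribbon_end E l v e s"
    using p unfolding vz boundary_points_def frontier_half_disc by (auto, force+)
  from z show "p \<in> (\<Union>u\<in>V. strand u)"
  proof
    assume "z \<in> diameter"
    then show ?thesis using v unfolding vz strand_def by auto
  next
    assume "z \<in> cis ` {0..pi}"
    then obtain x where x: "z = cis x" "x \<in> {0..pi}" by blast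
    have "cis x \<noteq> ribbon_point (degree v) r s"
      if r: "1 \<le> r" "r \<le> degree v" and s: "-1 < s" "s < 1" for r s
    proof -
      obtain e where "e \<in> incident_edges E v" "edge_rank E l v e = r" by (rule edge_rank_surj[OF r])
      then show ?thesis using avoid[of e s] s x by (simp add: ribbon_end_eq)
    qed
    from gap_cover[OF x(2) this] obtain k where k: "k \<le> degree v" "z \<in> gap (degree v) k"
      unfolding x(1) by blast
    obtain i where i: "i \<le> card E" "passed v i = k" by (rule passed_surj[OF k(1)])
    have perm: "position i permutes V" by (rule position_permutes[OF i(1)])
    define u where "u = inv (position i) v"
    have "position i u = v" unfolding u_def by (rule permutes_inverses(1)[OF perm])
    then have "(v, z) \<in> strand u" using i k(2) by (intro strand_gapI)
    moreover have "u \<in> V" using v permutes_in_image[OF permutes_inv[OF perm]] by (simp add: u_def)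
    ultimately show ?thesis using vz by blast
  qed
next
  fix p assume "p \<in> (\<Union>u\<in>V. strand u)"
  then obtain u where u: "u \<in> V" "p \<in> strand u" by blast
  obtain v z where vz: "p = (v, z)" by fastforce
  have "v \<in> V \<and> z \<in> frontier half_disc \<and>
      (\<forall>e\<in>incident_edges E v. \<forall>s\<in>{-1<..<1}. z \<noteq> ribbon_end E l v e s)"
    using u(2) unfolding vz
  proof (cases rule: strand_cases)
    case 1
    then show ?thesis
      using u(1) ribbon_point_notin_diameter[OF edge_rank_range]
      by (force simp: frontier_half_disc ribbon_end_eq)
  next
    case (2 i)
    have "v \<in> V" using 2(1,2) u(1) permutes_in_image[OF position_permutes] by metis
    moreover have "z \<in> frontier half_disc"
      using 2(3) gap_subset_frontier[OF passed_le_degree] by blast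
    moreover have "z \<noteq> ribbon_end E l v e s" if "e \<in> incident_edges E v" "s \<in> {-1<..<1}" for e s
      using ribbon_point_in_gap[OF edge_rank_range[OF that(1)] passed_le_degree[of v i], of s] that(2) 2(3)
      by (auto simp: ribbon_end_eq)
    ultimately show ?thesis by blast
  qed
  then show "p \<in> boundary_points" unfolding vz boundary_points_def by auto
qed

lemma strand_subset_discs:
  assumes "u \<in> V"
  shows "strand u \<subseteq> vertex_discs V"
proof -
  have "strand u \<subseteq> boundary_points"
    unfolding boundary_points_eq using assms by (rule UN_upper)
  also have "boundary_points \<subseteq> vertex_discs V"
    unfolding boundary_points_def vertex_discs_def
    by (rule Sigma_mono[OF subset_refl]) (rule subset_trans[OF Diff_subset frontier_half_disc_subset])
  finally show ?thesis .
qed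

lemma compact_strand: "compact (strand u)"
  unfolding strand_def
  by (intro compact_Un compact_UN compact_Times compact_gap compact_diameter) auto

section \<open>Connected components of the boundary\<close>

lemma quotient_map_surface:
  "quotient_map (top_of_set (vertex_discs V)) (surface V E l) (surface_point E l)"
  unfolding surface_def by (rule quotient_map_quotient_topology)

lemma sym_gluing: "sym (gluing E l)"
proof (rule symI)
  fix p q assume "(p, q) \<in> gluing E l"
  then obtain u v s where
    "p = (u, ribbon_end E l u {u, v} s)" "q = (v, ribbon_end E l v {u, v} (- s))"
    "{u, v} \<in> E" "u \<noteq> v" "s \<in> {-1..1}"
    unfolding gluing_def by blast
  then have "q = (v, ribbon_end E l v {v, u} (- s))" "p = (u, ribbon_end E l u {v, u} (- (- s)))"
    "{v, u} \<in> E" "v \<noteq> u" "- s \<in> {-1..1}"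
    by (auto simp: insert_commute)
  then show "(q, p) \<in> gluing E l" unfolding gluing_def by blast
qed

lemma surface_point_eq_iff: "surface_point E l p = surface_point E l q \<longleftrightarrow> (p, q) \<in> (gluing E l)\<^sup>*"
proof -
  have "equiv UNIV ((gluing E l)\<^sup>*)"
    using sym_gluing by (intro equivI) (auto intro: refl_rtrancl sym_rtrancl trans_rtrancl)
  from eq_equiv_class_iff[OF this, of p q] show ?thesis
    unfolding surface_point_def by simp
qed

text \<open>A union of strands is compact and saturated for the gluing, so it is its own preimage under the
  quotient map.\<close>

lemma closedin_strands:
  assumes "W \<subseteq> V"
  shows "closedin (surface V E l) (surface_point E l ` (\<Union>u\<in>W. strand u))"
proof -
  let ?U = "\<Union>u\<in>W. strand u"
  have sub: "?U \<subseteq> vertex_discs V" using assms strand_subset_discs by blast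
  have "compact ?U"
    using finite_subset[OF assms finite_V] compact_strand by (intro compact_UN) auto
  then have closed: "closedin (top_of_set (vertex_discs V)) ?U"
    using sub by (intro closed_subset compact_imp_closed)
  have saturated: "{x \<in> topspace (top_of_set (vertex_discs V)). surface_point E l x \<in> surface_point E l ` ?U} = ?U"
  proof (intro subset_antisym subsetI)
    fix x assume "x \<in> {x \<in> topspace (top_of_set (vertex_discs V)). surface_point E l x \<in> surface_point E l ` ?U}"
    then obtain y u where "u \<in> W" "y \<in> strand u" "surface_point E l y = surface_point E l x" by auto
    then show "x \<in> ?U" using strand_gluing_rtrancl unfolding surface_point_eq_iff by blast
  next
    fix x assume "x \<in> ?U"
    then show "x \<in> {x \<in> topspace (top_of_set (vertex_discs V)).
        surface_point E l x \<in> surface_point E l ` ?U}"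
      using subsetD[OF sub] by simp
  qed
  have "surface_point E l ` ?U \<subseteq> topspace (surface V E l)"
    unfolding surface_def topspace_quotient_topology using sub by auto
  from quotient_map_surface[unfolded quotient_map_closedin, THEN conjunct2, rule_format, OF this]
  show ?thesis unfolding saturated using closed by (rule iffD1)
qed

lemma connectedin_surface_image:
  assumes "connected S" "S \<subseteq> vertex_discs V"
  shows "connectedin (surface V E l) (surface_point E l ` S)"
  using assms by (intro connectedin_continuous_map_image[OF
        quotient_imp_continuous_map[OF quotient_map_surface]]) (simp add: connectedin_subtopology)

text \<open>Either the walker does not move and the gap stays the same, or it crosses the ribbon of the edge
  with label \<open>i + 1\<close>, where the last point of the old gap is glued to the first point of the new one.\<close>

lemma position_step_glued:
  assumes "i < card E"
  shows "surface_point E l ` ({position i u} \<times> gap (degree (position i u)) (passed (position i u) i)) \<inter>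
    surface_point E l ` ({position (Suc i) u} \<times>
      gap (degree (position (Suc i) u)) (passed (position (Suc i) u) (Suc i))) \<noteq> {}"
proof -
  define v where "v = position i u"
  have e: "edge (Suc i) \<in> E" "l (edge (Suc i)) = Suc i"
    using assms edge_in[of "Suc i"] label_edge[of "Suc i"] by auto
  show ?thesis
  proof (cases "v \<in> edge (Suc i)")
    case False
    have "position (Suc i) u = v"
      unfolding position_Suc v_def[symmetric] by (rule edge_transposition_notin[OF e(1) False])
    moreover have "passed v (Suc i) = passed v i"
      using passed_Suc[OF assms, of v] False by simp
    moreover have "gap (degree v) (passed v i) \<noteq> {}"
      using gap_start_in[OF passed_le_degree[of v i]] by blast
    ultimately show ?thesis unfolding v_def[symmetric] by simp
  next
    case True
    obtain a b where ab: "edge (Suc i) = {a, b}" "a \<noteq> b" using edge_endpoints[OF e(1)] by blast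
    define w where "w = (if v = a then b else a)"
    have w: "edge (Suc i) = {v, w}" "v \<noteq> w" using True ab by (auto simp: w_def)
    have pos: "position (Suc i) u = w"
      unfolding position_Suc v_def[symmetric] w(1) edge_transposition_pair by simp
    have pv: "passed v (Suc i) = Suc (passed v i)" and pw: "passed w (Suc i) = Suc (passed w i)"
      using passed_Suc[OF assms, of v] passed_Suc[OF assms, of w] w(1) by simp_all
    have rank: "edge_rank E l v {v, w} = Suc (passed v i)" "edge_rank E l w {v, w} = passed w (Suc i)"
      using e(2) pv unfolding edge_rank_eq_passed w(1) by simp_all
    let ?p = "(v, ribbon_end E l v {v, w} (-1))" and ?q = "(w, ribbon_end E l w {v, w} (- (-1)))"
    have "(?p, ?q) \<in> gluing E l"
      using e(1) w(2) unfolding gluing_def w(1) mem_Collect_eq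
      by (intro exI[of _ v] exI[of _ w] exI[of _ "-1"]) simp
    then have "surface_point E l ?p = surface_point E l ?q"
      unfolding surface_point_eq_iff by blast
    moreover have "?p \<in> {v} \<times> gap (degree v) (passed v i)"
      using passed_le_degree[of v "Suc i"] pv ribbon_point_first_in_gap[of "passed v i" "degree v"]
      by (simp add: ribbon_end_eq rank)
    moreover have "?q \<in> {w} \<times> gap (degree w) (passed w (Suc i))"
      using passed_le_degree[of w "Suc i"] pw
        ribbon_point_last_in_gap[of "passed w (Suc i)" "degree w"]
      by (simp add: ribbon_end_eq rank)
    ultimately show ?thesis unfolding pos v_def[symmetric] by (metis IntI emptyE image_eqI)
  qed
qed

text \<open>The diameter is followed by a chain of gaps, and consecutive pieces have a common point in the
  surface.\<close>

lemma connectedin_strand: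
  assumes "u \<in> V"
  shows "connectedin (surface V E l) (surface_point E l ` strand u)"
proof -
  define piece where
    "piece i = {position i u} \<times> gap (degree (position i u)) (passed (position i u) i)" for i
  have sub: "{u} \<times> diameter \<subseteq> vertex_discs V" "i \<le> card E \<Longrightarrow> piece i \<subseteq> vertex_discs V" for i
    using strand_subset_discs[OF assms] unfolding strand_def piece_def by auto
  have conn: "connectedin (surface V E l) (surface_point E l ` piece i)" if "i \<le> card E" for i
    using sub(2)[OF that] unfolding piece_def
    by (intro connectedin_surface_image connected_Times connected_gap connected_sing)
  have "connectedin (surface V E l) (surface_point E l ` ({u} \<times> diameter \<union> (\<Union>i\<le>n. piece i)))"
    if "n \<le> card E" for n
    using that
  proof (induction n)
    case 0
    have "(u, 1) \<in> {u} \<times> diameter" "(u, 1) \<in> piece 0"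
      using one_in_gap by (auto simp: piece_def passed_0 diameter_def image_iff intro!: bexI[of _ 1])
    then have "surface_point E l ` ({u} \<times> diameter) \<inter> surface_point E l ` piece 0 \<noteq> {}" by blast
    then show ?case
      using connectedin_Un[OF connectedin_surface_image[OF _ sub(1)] conn[of 0]]
      by (simp add: image_Un connected_Times connected_diameter)
  next
    case (Suc n)
    have "surface_point E l ` piece n \<inter> surface_point E l ` piece (Suc n) \<noteq> {}"
      unfolding piece_def using Suc.prems by (intro position_step_glued) simp
    then have "surface_point E l ` ({u} \<times> diameter \<union> (\<Union>i\<le>n. piece i)) \<inter>
        surface_point E l ` piece (Suc n) \<noteq> {}" by blast
    from connectedin_Un[OF Suc.IH conn[OF Suc.prems] this] Suc.prems
    show ?case by (simp add: atMost_Suc image_Un Un_ac)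
  qed
  from this[of "card E"] show ?thesis unfolding strand_def piece_def by simp
qed

text \<open>The strand of \<open>u\<close> is connected and touches the strand of the image of \<open>u\<close> at the left end of the
  diameter there, so strands in one orbit of the monodromy lie in one component. Conversely the strands
  of one orbit and the remaining strands form two disjoint closed sets covering the boundary, so no
  component contains strands from two orbits.\<close>

lemma card_boundary_components:
  "num_boundary_components V E l = card (orbit (monodromy E l) ` V)"
proof -
  let ?q = "surface_point E l" and ?\<mu> = "monodromy E l"
  define X where "X = subtopology (surface V E l) (surface_boundary V E l)"
  have bd: "surface_boundary V E l = ?q ` (\<Union>u\<in>V. strand u)"
    unfolding surface_boundary_def boundary_points_eq[symmetric] boundary_points_def ..
  have "?q ` (\<Union>u\<in>V. strand u) \<subseteq> topspace (surface V E l)"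
    by (rule closedin_subset[OF closedin_strands[OF subset_refl]])
  then have top: "topspace X = ?q ` (\<Union>u\<in>V. strand u)"
    unfolding X_def bd topspace_subtopology by (rule Int_absorb1)
  have closed: "closedin X (?q ` (\<Union>u\<in>W. strand u))" if "W \<subseteq> V" for W
    unfolding X_def bd
    by (intro closedin_subset_topspace closedin_strands image_mono UN_mono that subset_refl)
  have conn: "connectedin X (?q ` strand u)" if "u \<in> V" for u
    unfolding X_def bd connectedin_subtopology
    by (intro conjI connectedin_strand[OF that] image_mono UN_upper that)
  define base where "base u = ?q (u, 0)" for u
  have zero: "(u, 0) \<in> strand u" for u
    unfolding strand_def diameter_def by (auto intro!: image_eqI[of _ _ 0])
  have base: "connected_component_of X (base u) (?q p)" if "u \<in> V" "p \<in> strand u" for u p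
    unfolding connected_component_of_def base_def
    by (intro exI[of _ "?q ` strand u"] conjI conn[OF that(1)] imageI zero that(2))
  have \<mu>: "?\<mu> permutes V" unfolding monodromy_eq_position by (rule position_permutes) simp
  have step: "connected_component_of X (base u) (base (?\<mu> u))" if "u \<in> V" for u
  proof -
    let ?v = "?\<mu> u"
    have v: "?v \<in> V" using that permutes_in_image[OF \<mu>] by simp
    have "(?v, -1) \<in> strand u"
      using minus_one_in_gap
      by (intro strand_gapI[of "card E"]) (simp_all add: monodromy_eq_position passed_last)
    moreover have "(?v, -1) \<in> strand ?v"
      unfolding strand_def diameter_def by (auto intro!: image_eqI[of _ _ "-1"])
    ultimately show ?thesis
      using base[OF that] base[OF v] connected_component_of_sym connected_component_of_trans by metis
  qed
  have orbit: "connected_component_of X (base u) (base v)" if "u \<in> V" "v \<in> orbit ?\<mu> u" for u v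
    using that(2)
  proof induction
    case base
    show ?case by (rule step[OF that(1)])
  next
    case (step v)
    then have "v \<in> V" using permutes_orbit_subset[OF \<mu> that(1)] by blast
    then show ?case
      using step.IH \<open>\<And>u. u \<in> V \<Longrightarrow> connected_component_of X (base u) (base (?\<mu> u))\<close>
        connected_component_of_trans by metis
  qed
  have separate: "orbit ?\<mu> u = orbit ?\<mu> v"
    if uv: "u \<in> V" "v \<in> V" and cc: "connected_component_of X (base u) (base v)" for u v
  proof -
    define W where "W = {w \<in> V. orbit ?\<mu> w = orbit ?\<mu> u}"
    let ?F = "?q ` (\<Union>w\<in>W. strand w)" and ?G = "?q ` (\<Union>w\<in>V - W. strand w)"
    have disj: "?F \<inter> ?G = {}"
    proof (rule ccontr)
      assume "?F \<inter> ?G \<noteq> {}"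
      then obtain w w' p p' where w: "w \<in> W" "w' \<in> V - W" "p \<in> strand w" "p' \<in> strand w'"
        "?q p = ?q p'" by blast
      then have "p' \<in> strand w" using strand_gluing_rtrancl unfolding surface_point_eq_iff by blast
      then have "orbit ?\<mu> w = orbit ?\<mu> w'" using w(4) strand_meet by blast
      then show False using w by (auto simp: W_def)
    qed
    have "W \<subseteq> V" by (auto simp: W_def)
    then have "?F \<union> ?G = topspace X" unfolding top by blast
    then have "?F = topspace X - ?G" using disj by blast
    then have "openin X ?F" using closed[of "V - W"] by (simp add: openin_diff)
    moreover have "closedin X ?F" using \<open>W \<subseteq> V\<close> by (rule closed)
    moreover obtain T where T: "connectedin X T" "base u \<in> T" "base v \<in> T"
      using cc unfolding connected_component_of_def by blast
    ultimately have "T \<subseteq> ?F \<or> disjnt T ?F" by (intro connectedin_clopen_cases)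
    moreover have "base u \<in> ?F" using uv zero by (auto simp: base_def W_def)
    ultimately have "base v \<in> ?F" using T unfolding disjnt_iff by (meson subsetD)
    moreover have "base v \<in> ?G" if "v \<notin> W" using uv that zero by (auto simp: base_def)
    ultimately have "v \<in> W" using disj by blast
    then show ?thesis by (simp add: W_def)
  qed
  have "connected_components_of X = (\<lambda>u. connected_component_of_set X (base u)) ` V"
  proof -
    have "connected_component_of_set X (?q p) = connected_component_of_set X (base u)"
      if "u \<in> V" "p \<in> strand u" for u p
      using base[OF that] connected_component_of_equiv by metis
    moreover have "base u \<in> topspace X" if "u \<in> V" for u
      unfolding top base_def using that zero by blast
    ultimately show ?thesis unfolding connected_components_of_def by (auto simp: top)
  qed
  then have "num_boundary_components V E l = card ((\<lambda>u. connected_component_of_set X (base u)) ` V)"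
    unfolding num_boundary_components_def X_def by simp
  also have "\<dots> = card (orbit ?\<mu> ` V)"
  proof (rule card_image_cong)
    fix u v assume uv: "u \<in> V" "v \<in> V"
    have top_u: "base u \<in> topspace X" "base v \<in> topspace X"
      unfolding top base_def using uv zero by blast+
    have "connected_component_of_set X (base u) = connected_component_of_set X (base v)
        \<longleftrightarrow> connected_component_of X (base u) (base v)"
      using top_u connected_component_of_equiv[of X "base u" "base v"] by (auto simp: fun_eq_iff set_eq_iff)
    also have "\<dots> \<longleftrightarrow> orbit ?\<mu> u = orbit ?\<mu> v"
      using separate[OF uv] orbit[OF uv(1), of v] orbit_eq_iff_mem[OF finite_V \<mu>] by blast
    finally show "connected_component_of_set X (base u) = connected_component_of_set X (base v)
        \<longleftrightarrow> orbit ?\<mu> u = orbit ?\<mu> v" .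
  qed
  finally show ?thesis .
qed

end

section \<open>Labelings of complete graphs\<close>

lemma num_boundary_components_complete:
  assumes "edge_labeling (complete_edges n) l"
  shows "num_boundary_components {1..n} (complete_edges n) l =
    num_cycles n (monodromy (complete_edges n) l)"
proof -
  interpret labeled_graph "{1..n}" "complete_edges n" l
    using assms by unfold_locales (simp_all add: complete_edges_def complete_on_def)
  show ?thesis by (simp only: card_boundary_components num_cycles_def)
qed

lemma sign_eq_of_cycle_parity:
  assumes "p permutes {1..n}" "[int (num_cycles n p) = int n - int (n choose 2)] (mod 2)"
  shows "sign p = (-1) ^ (n choose 2)"
proof -
  have "even (int n + int (num_cycles n p)) \<longleftrightarrow> even (int (n choose 2))"
    using assms(2) by (simp add: cong_iff_dvd_diff) blast
  then have "even (n + num_cycles n p) \<longleftrightarrow> even (n choose 2)"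
    by (metis even_of_nat of_nat_add)
  then have "(-1) ^ (n + num_cycles n p) = ((-1) ^ (n choose 2) :: int)"
    by (metis neg_one_even_power neg_one_odd_power)
  moreover have "sign p = (-1) ^ (n + num_cycles n p)"
    using sign_card_orbits[OF finite_atLeastAtMost assms(1)] by (simp add: num_cycles_def)
  ultimately show ?thesis by simp
qed

text \<open>The parity condition on the number of cycles is a condition on the sign, which is the only
  obstruction to being an ordered product of all transpositions.\<close>

lemma exists_labeling_with_monodromy:
  assumes "p permutes {1..n}" "[int (num_cycles n p) = int n - int (n choose 2)] (mod 2)"
  shows "\<exists>l. edge_labeling (complete_edges n) l \<and> monodromy (complete_edges n) l = p"
proof -
  have "ordered_product (complete_on {1..n}) p"
    using assms(1) sign_eq_of_cycle_parity[OF assms]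
    by (intro ordered_product_complete) simp_all
  then have "ordered_product (complete_edges n) p"
    unfolding complete_on_def complete_edges_def .
  then show ?thesis by (rule exists_labeling)
qed

theorem theorem4p22:
  fixes n :: nat
  assumes "n \<ge> 1"
  shows
    "(\<forall>b::nat. 1 \<le> b \<and> b \<le> n \<and> [int b = int n - int (n choose 2)] (mod 2) \<longrightarrow>
        (\<exists>l. edge_labeling (complete_edges n) l \<and>
             num_cycles n (monodromy (complete_edges n) l) = b \<and>
             num_boundary_components {1..n} (complete_edges n) l = b)) \<and>
     (\<forall>l (b::nat). edge_labeling (complete_edges n) l \<longrightarrow>
        (num_cycles n (monodromy (complete_edges n) l) = b \<longleftrightarrow>
         num_boundary_components {1..n} (complete_edges n) l = b)) \<and>
     (\<forall>C \<in> conjugacy_classes n.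
        (\<forall>p \<in> C. [int (num_cycles n p) = int n - int (n choose 2)] (mod 2)) \<longrightarrow>
        (\<exists>l. edge_labeling (complete_edges n) l \<and> monodromy (complete_edges n) l \<in> C))"
proof (intro conjI allI impI ballI)
  fix b :: nat assume b: "1 \<le> b \<and> b \<le> n \<and> [int b = int n - int (n choose 2)] (mod 2)"
  then obtain p where p: "p permutes {1..n}" "num_cycles n p = b"
    using exists_permutation_card_orbits[of b n] unfolding num_cycles_def by blast
  then obtain l where "edge_labeling (complete_edges n) l" "monodromy (complete_edges n) l = p"
    using exists_labeling_with_monodromy[of p n] b by blast
  then show "\<exists>l. edge_labeling (complete_edges n) l \<and>
      num_cycles n (monodromy (complete_edges n) l) = b \<and>
      num_boundary_components {1..n} (complete_edges n) l = b"
    using num_boundary_components_complete p(2) by metis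
next
  fix l and b :: nat assume "edge_labeling (complete_edges n) l"
  then show "num_cycles n (monodromy (complete_edges n) l) = b \<longleftrightarrow>
      num_boundary_components {1..n} (complete_edges n) l = b"
    by (simp only: num_boundary_components_complete)
next
  fix C assume "C \<in> conjugacy_classes n"
    and parity: "\<forall>p\<in>C. [int (num_cycles n p) = int n - int (n choose 2)] (mod 2)"
  then obtain p where p: "p permutes {1..n}" "C = conjugacy_class n p"
    unfolding conjugacy_classes_def by blast
  have "p = id \<circ> p \<circ> inv id" by (simp only: inv_id id_comp comp_id)
  then have "p \<in> C" unfolding p(2) conjugacy_class_def using permutes_id by blast
  then show "\<exists>l. edge_labeling (complete_edges n) l \<and> monodromy (complete_edges n) l \<in> C"
    using exists_labeling_with_monodromy[OF p(1)] parity by blast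
qed

end
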